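(* Fix a MAC grid and a time step $\delta t$. Let $(\varepsilon^{(m)})_{m\in\mathbb N}$ be a sequence of positive real numbers tending to zero, and let $(\rho^{(m)},\boldsymbol u^{(m)},\phi^{(m)})$ be a corresponding sequence of solutions of the scheme (M), (U), (P) of the context with $\varepsilon=\varepsilon^{(m)}$. Assume that the initial data $(\rho_0^{\varepsilon^{(m)}},\boldsymbol u_0^{\varepsilon^{(m)}},\phi_0^{\varepsilon^{(m)}})$ are well-prepared in the sense of the context, and that $0<\underline C<(\rho^{(m)})^n_K<\bar C$ for all $K\in\mathcal M$, $0\le n\le N$, $m\in\mathbb N$, with $\underline C,\bar C$ possibly depending on the mesh and the time-step but not on $\varepsilon^{(m)}$. Then, up to a subsequence, $(\rho^{(m)},\boldsymbol u^{(m)},\phi^{(m)})$ tends, in any discrete norm, to a function $(\tilde\rho,\boldsymbol U,\ln\tilde\rho)\in L^\infty(0,T;L_{\mathcal M}(\Omega)\times\boldsymbol H_{\mathcal E,0}(\Omega)\times L_{\mathcal M}(\Omega))$ when $m\to\infty$, and $(\tilde\rho,\boldsymbol U)$ satisfies the following semi-implicit scheme for all $0\le n\le N-1$: $$\frac1{\delta t}(\tilde\rho^{n+1}_K-\tilde\rho^n_K)+\frac1{|K|}\sum_{\sigma\in\mathcal E(K)}F^{n,n+1}_{\sigma,K}=0,\quad\forall K\in\mathcal M,$$ $$\frac1{\delta t}(\tilde\rho^{n+1}_{D_\sigma}U^{n+1}_\sigma-\tilde\rho^n_{D_\sigma}U^n_\sigma)+\frac1{|D_\sigma|}\sum_{\epsilon\in\tilde{\mathcal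 E}(D_\sigma)}F^{n,n+1}_{\epsilon,\sigma}U^n_{\epsilon,\mathrm{up}}+(\partial^{(i)}_{\mathcal E}\tilde\rho^{n+1})^*_\sigma=0,\quad 1\le i\le d,\ \forall\sigma\in\mathcal E^{(i)}_{\mathrm{int}},$$ where $$F^{n,n+1}_{\sigma,K}=|\sigma|\big(\tilde\rho^n_\sigma U^n_{\sigma,K}-\eta\,\delta t\,(\partial^{(i)}_{\mathcal E}\ln\tilde\rho^{n+1})_{\sigma,K}\big),$$ $$(\partial^{(i)}_{\mathcal E}\tilde\rho^{n+1})^*_\sigma=(\partial^{(i)}_{\mathcal E}\tilde\rho^{n+1})_\sigma-(\tilde\rho^{n+1}_\sigma-\tilde\rho^n_\sigma)(\partial^{(i)}_{\mathcal E}\ln\tilde\rho^{n+1})_\sigma-\delta t\,(\partial^{(i)}_{\mathcal E}(\mathrm{div}_{\mathcal M}\boldsymbol U^n))_\sigma,$$ with $\eta>\frac{5(\tilde\rho^n_\sigma)^2}{4\tilde\rho^n_{D_\sigma}}$, and where, for $\sigma=K|L$, $\tilde\rho_\sigma$ is the logarithmic mean of $\tilde\rho_K,\tilde\rho_L$ as in the context, and the dual fluxes $F^{n,n+1}_{\epsilon,\sigma}$ and upwind values $U_{\epsilon,\mathrm{up}}$ are built from $F^{n,n+1}_{\sigma,K}$ and $\boldsymbol U$ as in the context.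
   Context: MAC grid. $\Omega\subset\mathbb R^d$, $d=1,2,3$, is open, bounded, connected, and $\bar\Omega$ is a union of closed rectangles ($d=2$) or closed orthogonal parallelepipeds ($d=3$; intervals if $d=1$) with mutually disjoint interiors and edges (faces) orthogonal to the canonical basis vectors $\boldsymbol e^{(1)},\dots,\boldsymbol e^{(d)}$. A MAC grid $(\mathcal M,\mathcal E)$ consists of a partition $\mathcal M$ of $\bar\Omega$ into possibly non-uniform closed cells of this type (primal cells) and the set $\mathcal E$ of all their edges; $\mathcal E_{\mathrm{int}},\mathcal E_{\mathrm{ext}}$ are the internal and external edges, $\mathcal E^{(i)}$ the edges orthogonal to $\boldsymbol e^{(i)}$, $\mathcal E^{(i)}_{\mathrm{int}}=\mathcal E^{(i)}\cap\mathcal E_{\mathrm{int}}$, $\mathcal E(K)$ the edges of $K$. $\sigma=K|L$ means that $\sigma=K\cap L$ is internal. $D_{\sigma,K}$ is the half of $K$ adjacent to $\sigma$; the dual cell is $D_\sigma=D_{\sigma,K}\cup D_{\sigma,L}$ for $\sigma=K|L$, and $D_\sigma=D_{\sigma,K}$ for $\sigma\in\mathcal E_{\mathrm{ext}}$ adjacent to $K$. $\tilde{\mathcal E}(D_\sigma)$ is the set of edges of $D_\sigma$; $\epsilon=D_\sigma|D_{\sigma'}$ denotes an edge separating two dual cells. $|\cdot|$ is the $d$- or $(d-1)$-dimensional measure; $\boldsymbol\nu_{\sigma,K}$ is the unit normal to $\sigma$ outward to $K$. Spaces. $L_{\mathcal M}(\Omega)$: functions constant on each $K\in\mathcal M$ (values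 $q_K$). $\boldsymbol H_{\mathcal E,0}(\Omega)$: vector functions whose $i$-th component is constant on each $D_\sigma$, $\sigma\in\mathcal E^{(i)}$ (values $v_\sigma$), and vanishes on external edges. For edge quantities, a second index $K$ means multiplication by $\boldsymbol e^{(i)}\cdot\boldsymbol\nu_{\sigma,K}$: $v_{\sigma,K}=v_\sigma\boldsymbol e^{(i)}\cdot\boldsymbol\nu_{\sigma,K}$. Dual average: $|D_\sigma|q_{D_\sigma}=|D_{\sigma,K}|q_K+|D_{\sigma,L}|q_L$ for $\sigma=K|L$. Discrete operators. $(\partial^{(i)}_{\mathcal E}q)_\sigma=\frac{|\sigma|}{|D_\sigma|}(q_L-q_K)\boldsymbol e^{(i)}\cdot\boldsymbol\nu_{\sigma,K}$ for $\sigma=K|L\in\mathcal E^{(i)}_{\mathrm{int}}$, and $0$ on external edges; $\nabla_{\mathcal E}q=(\partial^{(1)}_{\mathcal E}q,\dots,\partial^{(d)}_{\mathcal E}q)$; $(\mathrm{div}_{\mathcal M}\boldsymbol v)_K=\frac1{|K|}\sum_{\sigma\in\mathcal E(K)}|\sigma|v_{\sigma,K}$; $\Delta_{\mathcal M}q=\mathrm{div}_{\mathcal M}(\nabla_{\mathcal E}q)$. Scheme. $0=t_0<\dots<t_N=T$ with constant step $\delta t$. Unknowns: $\rho^n,\phi^n\in L_{\mathcal M}(\Omega)$, $\boldsymbol u^n\in\boldsymbol H_{\mathcal E,0}(\Omega)$. For $\sigma=K|L$, $\rho_\sigma=\frac{\rho_K-\rho_L}{\ln\rho_K-\ln\rho_L}$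 if $\rho_K\ne\rho_L$, and $\rho_\sigma=\rho_K$ otherwise. Stabilisation terms: $Q^{n+1}_\sigma=\eta\,\delta t\,(\partial^{(i)}_{\mathcal E}\phi^{n+1})_\sigma$ for $\sigma\in\mathcal E^{(i)}_{\mathrm{int}}$ (zero on external edges), $\Lambda^n_K=\frac{\delta t}{|K|}\sum_{\sigma\in\mathcal E(K)}|\sigma|u^n_{\sigma,K}$, the parameter $\eta$ being chosen at each interface $\sigma$ such that $\eta>\frac{5(\rho^n_\sigma)^2}{4\rho^n_{D_\sigma}}$. Mass flux: $F^n_{\sigma,K}=|\sigma|(\rho^n_\sigma u^n_{\sigma,K}-Q^{n+1}_{\sigma,K})$ (zero on external edges). The dual flux $F_{\epsilon,\sigma}$ across $\epsilon\in\tilde{\mathcal E}(D_\sigma)$ (outward to $D_\sigma$) is a suitable linear combination, with constant coefficients, of the primal mass fluxes at the neighbouring edges if $\epsilon$ is internal, and $0$ otherwise, such that averaging the mass equation over a dual cell gives $\frac1{\delta t}(\rho^{n+1}_{D_\sigma}-\rho^n_{D_\sigma})+\frac1{|D_\sigma|}\sum_{\epsilon\in\tilde{\mathcal E}(D_\sigma)}F^n_{\epsilon,\sigma}=0$ (in the usual MAC choice, for $\sigma=K|L\in\mathcal E^{(i)}_{\mathrm{int}}$: if $\epsilon\subset K$ separates $\sigma$ from the opposite face $\sigma'$ of $K$, $F_{\epsilon,\sigma}=\frac12(F_{\sigma',K}-F_{\sigma,K})$; if $\epsilon$ is made of halves of faces $\tau$ of $K$ and $\tau'$ of $L$ not orthogonal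 to $\boldsymbol e^{(i)}$, $F_{\epsilon,\sigma}=\frac12(F_{\tau,K}+F_{\tau',L})$). Upwind velocity: for $\epsilon=D_\sigma|D_{\sigma'}$, $u_{\epsilon,\mathrm{up}}=u_\sigma$ if $F_{\epsilon,\sigma}\ge0$, $u_{\sigma'}$ otherwise. For $0\le n\le N-1$: (M) $\frac1{\delta t}(\rho^{n+1}_K-\rho^n_K)+\frac1{|K|}\sum_{\sigma\in\mathcal E(K)}F^n_{\sigma,K}=0$, for all $K\in\mathcal M$; (U) $\frac1{\delta t}(\rho^{n+1}_{D_\sigma}u^{n+1}_\sigma-\rho^n_{D_\sigma}u^n_\sigma)+\frac1{|D_\sigma|}\sum_{\epsilon\in\tilde{\mathcal E}(D_\sigma)}F^n_{\epsilon,\sigma}u^n_{\epsilon,\mathrm{up}}=-\rho^n_\sigma(\partial^{(i)}_{\mathcal E}\phi^{n+1})_\sigma+(\partial^{(i)}_{\mathcal E}\Lambda^n)_\sigma$, for $1\le i\le d$, $\sigma\in\mathcal E^{(i)}_{\mathrm{int}}$; (P) $-\varepsilon^2(\Delta_{\mathcal M}\phi^{n+1})_K=\rho^{n+1}_K-e^{\phi^{n+1}_K}$, for all $K\in\mathcal M$. Initialisation by averages: $\rho^0_K=\frac1{|K|}\int_K\rho_0^\varepsilon$, $\phi^0_K=\frac1{|K|}\int_K\phi_0^\varepsilon$, $u^0_\sigma=\frac1{|D_\sigma|}\int_{D_\sigma}(\boldsymbol u_0^\varepsilon)_i$ for $\sigma\in\mathcal E^{(i)}_{\mathrm{int}}$.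 Discrete solutions are identified with functions piecewise constant in time. Well-prepared data: $\rho_0^\varepsilon\in L^\infty(\Omega)$, $\rho_0^\varepsilon>0$ a.e., $\boldsymbol u_0^\varepsilon\in L^2(\Omega)^d$, $\phi_0^\varepsilon\in L^\infty(\Omega)$, and there exist a constant $C>0$ independent of $\varepsilon$ and a positive function $\tilde\rho_0\in L^\infty(\Omega)$ such that (i) $\rho_0^\varepsilon\to\tilde\rho_0$ in $L^2(\Omega)$ as $\varepsilon\to0$; (ii) $\int_\Omega\big(\frac{\varepsilon^2}2|\nabla\phi_0^\varepsilon|^2+(\phi_0^\varepsilon-1)e^{\phi_0^\varepsilon}+\frac12\rho_0^\varepsilon|\boldsymbol u_0^\varepsilon|^2\big)dx\le C$ for all $\varepsilon>0$.
   Formalization: Added, since the claim fails otherwise: initial densities bounded below a.e. uniformly in m; η may depend on m but is bounded and exceeds its threshold by a margin uniform in m, the limit scheme using the limit of η. Convergence of φ to the log of the density is stated for n≥1 only. *)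

theory Defs
  imports "HOL-Analysis.Analysis"
begin

section \<open>MAC grids\<close>

text \<open>Cells and edges are subsets of $\mathbb R^d$ with $d$ the cardinality of the index type;
  the unknowns are the arrays of their values, indexed by these sets.  An edge determines its
  direction, so the $d$ families of normal velocities form one array indexed by edges.\<close>

record ('d::finite) mac_mesh =
  region :: "(real^'d) set"
  cells :: "(real^'d) set set"

definition edges_of :: "(real^'d) set \<Rightarrow> (real^'d) set set" where
  "edges_of K = {\<sigma>. \<sigma> facet_of K}"

definition edges :: "'d::finite mac_mesh \<Rightarrow> (real^'d) set set" where
  "edges G = (\<Union>K\<in>cells G. edges_of K)"

definition ext_edges :: "'d::finite mac_mesh \<Rightarrow> (real^'d) set set" where
  "ext_edges G = {\<sigma> \<in> edges G. \<sigma> \<subseteq> frontier (region G)}"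

definition int_edges :: "'d::finite mac_mesh \<Rightarrow> (real^'d) set set" where
  "int_edges G = edges G - ext_edges G"

definition orthogonal_to_axis :: "'d::finite \<Rightarrow> (real^'d) set \<Rightarrow> bool" where
  "orthogonal_to_axis i \<sigma> \<longleftrightarrow> (\<exists>c. \<forall>x\<in>\<sigma>. x $ i = c)"

definition int_edges_dir :: "'d::finite mac_mesh \<Rightarrow> 'd \<Rightarrow> (real^'d) set set" where
  "int_edges_dir G i = {\<sigma> \<in> int_edges G. orthogonal_to_axis i \<sigma>}"

definition edge_dir :: "(real^'d::finite) set \<Rightarrow> 'd" where
  "edge_dir \<sigma> = (THE i. orthogonal_to_axis i \<sigma>)"

text \<open>\<open>interface G K L \<sigma>\<close> is $\sigma = K|L$.\<close>

definition interface ::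
  "'d::finite mac_mesh \<Rightarrow> (real^'d) set \<Rightarrow> (real^'d) set \<Rightarrow> (real^'d) set \<Rightarrow> bool" where
  "interface G K L \<sigma> \<longleftrightarrow>
     K \<in> cells G \<and> L \<in> cells G \<and> K \<noteq> L \<and> \<sigma> = K \<inter> L \<and> \<sigma> \<in> int_edges G"

text \<open>The last two clauses express conformity (no hanging nodes), which is implicit in the fact
  that each internal edge is a complete face of the two cells which it separates.\<close>

definition mac_grid :: "'d::finite mac_mesh \<Rightarrow> bool" where
  "mac_grid G \<longleftrightarrow>
     open (region G) \<and> bounded (region G) \<and> connected (region G) \<and>
     cells G division_of closure (region G) \<and>
     (\<forall>K\<in>cells G. interior K \<noteq> {}) \<and>
     (\<forall>K\<in>cells G. \<forall>L\<in>cells G. K \<noteq> L \<and> aff_dim (K \<inter> L) = int CARD('d) - 1 \<longrightarrow>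
        K \<inter> L \<in> edges_of K \<and> K \<inter> L \<in> edges_of L) \<and>
     (\<forall>\<sigma>\<in>int_edges G. \<exists>K L. interface G K L \<sigma>)"

definition outward_normal :: "(real^'d::finite) set \<Rightarrow> (real^'d) set \<Rightarrow> real^'d" where
  "outward_normal \<sigma> K = (THE \<nu>. norm \<nu> = 1 \<and> (\<forall>x\<in>\<sigma>. \<forall>y\<in>K. \<nu> \<bullet> (y - x) \<le> 0))"

text \<open>The number $e^{(i)} \cdot \nu_{\sigma,K}$, for $\sigma$ orthogonal to $e^{(i)}$.\<close>

definition edge_sign :: "(real^'d::finite) set \<Rightarrow> (real^'d) set \<Rightarrow> real" where
  "edge_sign \<sigma> K = axis (edge_dir \<sigma>) 1 \<bullet> outward_normal \<sigma> K"

abbreviation vol :: "(real^'d::finite) set \<Rightarrow> real" where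
  "vol A \<equiv> measure lebesgue A"

text \<open>The $(d-1)$-dimensional measure of an edge, which is a degenerate box; an edge has measure 1
  if $d = 1$.\<close>

definition edge_measure :: "(real^'d::finite) set \<Rightarrow> real" where
  "edge_measure \<sigma> =
     (\<Prod>j \<in> UNIV - {edge_dir \<sigma>}. interval_upperbound \<sigma> $ j - interval_lowerbound \<sigma> $ j)"

text \<open>\<open>half_cell \<sigma> K\<close> is $D_{\sigma,K}$.  The union in \<open>dual_cell\<close> has two terms if $\sigma$ is internal and
  one term if $\sigma$ is external.\<close>

definition half_cell :: "(real^'d::finite) set \<Rightarrow> (real^'d) set \<Rightarrow> (real^'d) set" where
  "half_cell \<sigma> K = (let i = edge_dir \<sigma> in
     {x \<in> K. \<forall>s\<in>\<sigma>. \<bar>x $ i - s $ i\<bar> \<le> (interval_upperbound K $ i - interval_lowerbound K $ i) / 2})"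

definition dual_cell :: "'d::finite mac_mesh \<Rightarrow> (real^'d) set \<Rightarrow> (real^'d) set" where
  "dual_cell G \<sigma> = (\<Union>K \<in> {K \<in> cells G. \<sigma> \<in> edges_of K}. half_cell \<sigma> K)"

definition dual_edges :: "'d::finite mac_mesh \<Rightarrow> (real^'d) set \<Rightarrow> (real^'d) set set" where
  "dual_edges G \<sigma> = {\<epsilon>. \<epsilon> facet_of dual_cell G \<sigma>}"

text \<open>The edge $\sigma'$ such that $\epsilon = D_\sigma|D_{\sigma'}$.  At a reentrant corner of the domain $D_{\sigma'}$ may
  touch only a part of $\epsilon$, whence the inclusion.\<close>

definition dual_neighbour ::
  "'d::finite mac_mesh \<Rightarrow> (real^'d) set \<Rightarrow> (real^'d) set \<Rightarrow> (real^'d) set" where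
  "dual_neighbour G \<epsilon> \<sigma> = (THE \<sigma>'. \<sigma>' \<in> edges G \<and> \<sigma>' \<noteq> \<sigma> \<and> edge_dir \<sigma>' = edge_dir \<sigma> \<and>
     dual_cell G \<sigma> \<inter> dual_cell G \<sigma>' \<subseteq> \<epsilon> \<and>
     aff_dim (dual_cell G \<sigma> \<inter> dual_cell G \<sigma>') = int CARD('d) - 1)"

section \<open>Discrete spaces and operators\<close>

definition L_M :: "'d::finite mac_mesh \<Rightarrow> ((real^'d) set \<Rightarrow> real) set" where
  "L_M G = {q. \<forall>K. K \<notin> cells G \<longrightarrow> q K = 0}"

definition H_E0 :: "'d::finite mac_mesh \<Rightarrow> ((real^'d) set \<Rightarrow> real) set" where
  "H_E0 G = {v. \<forall>\<sigma>. \<sigma> \<notin> int_edges G \<longrightarrow> v \<sigma> = 0}"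

text \<open>For an internal edge, the two cells $K, L$ with $\sigma = K|L$ in some order.  All the
  expressions below are symmetric in $K$ and $L$.\<close>

definition adjacent_cells ::
  "'d::finite mac_mesh \<Rightarrow> (real^'d) set \<Rightarrow> (real^'d) set \<times> (real^'d) set" where
  "adjacent_cells G \<sigma> = (SOME (K, L). interface G K L \<sigma>)"

definition log_mean :: "real \<Rightarrow> real \<Rightarrow> real" where
  "log_mean a b = (if a \<noteq> b then (a - b) / (ln a - ln b) else a)"

definition edge_density ::
  "'d::finite mac_mesh \<Rightarrow> ((real^'d) set \<Rightarrow> real) \<Rightarrow> (real^'d) set \<Rightarrow> real" where
  "edge_density G \<rho> \<sigma> = (case adjacent_cells G \<sigma> of (K, L) \<Rightarrow> log_mean (\<rho> K) (\<rho> L))"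

definition dual_average ::
  "'d::finite mac_mesh \<Rightarrow> ((real^'d) set \<Rightarrow> real) \<Rightarrow> (real^'d) set \<Rightarrow> real" where
  "dual_average G q \<sigma> = (case adjacent_cells G \<sigma> of (K, L) \<Rightarrow>
     (vol (half_cell \<sigma> K) * q K + vol (half_cell \<sigma> L) * q L) / vol (dual_cell G \<sigma>))"

definition grad_E ::
  "'d::finite mac_mesh \<Rightarrow> ((real^'d) set \<Rightarrow> real) \<Rightarrow> (real^'d) set \<Rightarrow> real" where
  "grad_E G q \<sigma> = (if \<sigma> \<in> int_edges G
     then (case adjacent_cells G \<sigma> of (K, L) \<Rightarrow>
       edge_measure \<sigma> / vol (dual_cell G \<sigma>) * (q L - q K) * edge_sign \<sigma> K)
     else 0)"

definition div_M ::
  "((real^'d::finite) set \<Rightarrow> real) \<Rightarrow> (real^'d) set \<Rightarrow> real" where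
  "div_M v K = 1 / vol K * (\<Sum>\<sigma>\<in>edges_of K. edge_measure \<sigma> * (v \<sigma> * edge_sign \<sigma> K))"

definition laplacian_M ::
  "'d::finite mac_mesh \<Rightarrow> ((real^'d) set \<Rightarrow> real) \<Rightarrow> (real^'d) set \<Rightarrow> real" where
  "laplacian_M G q = div_M (grad_E G q)"

section \<open>Fluxes\<close>

text \<open>\<open>mass_flux G \<delta>t \<eta> \<rho> u \<psi> \<sigma> K\<close> is the flux $F_{\sigma,K}$ with stabilisation
  $Q_\sigma = \eta_\sigma\,\delta t\,(\partial^{(i)}_{\mathcal E}\psi)_\sigma$; the scheme has $\psi = \phi^{n+1}$ and the limit
  scheme has $\psi = \ln\tilde\rho^{n+1}$.\<close>

definition mass_flux ::
  "'d::finite mac_mesh \<Rightarrow> real \<Rightarrow> ((real^'d) set \<Rightarrow> real) \<Rightarrow> ((real^'d) set \<Rightarrow> real) \<Rightarrow>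
   ((real^'d) set \<Rightarrow> real) \<Rightarrow> ((real^'d) set \<Rightarrow> real) \<Rightarrow> (real^'d) set \<Rightarrow> (real^'d) set \<Rightarrow> real" where
  "mass_flux G \<delta>t \<eta> \<rho> u \<psi> \<sigma> K = (if \<sigma> \<in> int_edges G
     then edge_measure \<sigma> * (edge_density G \<rho> \<sigma> * (u \<sigma> * edge_sign \<sigma> K)
                              - (\<eta> \<sigma> * \<delta>t * grad_E G \<psi> \<sigma>) * edge_sign \<sigma> K)
     else 0)"

text \<open>A family of dual fluxes is given by constant coefficients: \<open>w \<epsilon> \<sigma> \<tau> K\<close> is the coefficient of
  $F_{\tau,K}$ in $F_{\epsilon,\sigma}$.\<close>

definition dual_flux ::
  "'d::finite mac_mesh \<Rightarrow>
   ((real^'d) set \<Rightarrow> (real^'d) set \<Rightarrow> (real^'d) set \<Rightarrow> (real^'d) set \<Rightarrow> real) \<Rightarrow>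
   ((real^'d) set \<Rightarrow> (real^'d) set \<Rightarrow> real) \<Rightarrow> (real^'d) set \<Rightarrow> (real^'d) set \<Rightarrow> real" where
  "dual_flux G w F \<epsilon> \<sigma> = (\<Sum>K\<in>cells G. \<Sum>\<tau>\<in>edges_of K. w \<epsilon> \<sigma> \<tau> K * F \<tau> K)"

definition conservative_flux ::
  "'d::finite mac_mesh \<Rightarrow> ((real^'d) set \<Rightarrow> (real^'d) set \<Rightarrow> real) \<Rightarrow> bool" where
  "conservative_flux G F \<longleftrightarrow>
     (\<forall>K L \<sigma>. interface G K L \<sigma> \<longrightarrow> F \<sigma> K = - F \<sigma> L) \<and> (\<forall>\<sigma>\<in>ext_edges G. \<forall>K. F \<sigma> K = 0)"

text \<open>Admissible coefficients: the dual flux through an edge of $D_\sigma$ on the boundary vanishes, only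
  the fluxes through the edges of the two cells adjacent to $\sigma$ contribute, and the primal mass
  balance always implies the dual one.  The usual MAC choice, with coefficients $\pm\frac12$, is
  an instance.\<close>

definition dual_flux_weights ::
  "'d::finite mac_mesh \<Rightarrow>
   ((real^'d) set \<Rightarrow> (real^'d) set \<Rightarrow> (real^'d) set \<Rightarrow> (real^'d) set \<Rightarrow> real) \<Rightarrow> bool" where
  "dual_flux_weights G w \<longleftrightarrow>
     (\<forall>\<sigma>\<in>int_edges G. \<forall>\<epsilon>\<in>dual_edges G \<sigma>. \<forall>K\<in>cells G. \<forall>\<tau>\<in>edges_of K.
        (\<epsilon> \<subseteq> frontier (region G) \<or> \<sigma> \<notin> edges_of K \<longrightarrow> w \<epsilon> \<sigma> \<tau> K = 0)) \<and>
     (\<forall>\<delta>t \<rho> \<rho>' F. \<delta>t > 0 \<and> conservative_flux G F \<and>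
        (\<forall>K\<in>cells G. 1 / \<delta>t * (\<rho>' K - \<rho> K) + 1 / vol K * (\<Sum>\<sigma>\<in>edges_of K. F \<sigma> K) = 0) \<longrightarrow>
        (\<forall>\<sigma>\<in>int_edges G.
           1 / \<delta>t * (dual_average G \<rho>' \<sigma> - dual_average G \<rho> \<sigma>)
           + 1 / vol (dual_cell G \<sigma>) * (\<Sum>\<epsilon>\<in>dual_edges G \<sigma>. dual_flux G w F \<epsilon> \<sigma>) = 0))"

definition upwind ::
  "'d::finite mac_mesh \<Rightarrow>
   ((real^'d) set \<Rightarrow> (real^'d) set \<Rightarrow> (real^'d) set \<Rightarrow> (real^'d) set \<Rightarrow> real) \<Rightarrow>
   ((real^'d) set \<Rightarrow> (real^'d) set \<Rightarrow> real) \<Rightarrow> ((real^'d) set \<Rightarrow> real) \<Rightarrow>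
   (real^'d) set \<Rightarrow> (real^'d) set \<Rightarrow> real" where
  "upwind G w F u \<epsilon> \<sigma> = (if dual_flux G w F \<epsilon> \<sigma> \<ge> 0 then u \<sigma> else u (dual_neighbour G \<epsilon> \<sigma>))"

section \<open>The scheme and its limit\<close>

definition eta_condition ::
  "'d::finite mac_mesh \<Rightarrow> ((real^'d) set \<Rightarrow> real) \<Rightarrow> ((real^'d) set \<Rightarrow> real) \<Rightarrow> bool" where
  "eta_condition G \<rho> \<eta> \<longleftrightarrow>
     (\<forall>\<sigma>\<in>int_edges G. \<eta> \<sigma> > 5 * (edge_density G \<rho> \<sigma>)\<^sup>2 / (4 * dual_average G \<rho> \<sigma>))"

definition mac_scheme ::
  "'d::finite mac_mesh \<Rightarrow>
   ((real^'d) set \<Rightarrow> (real^'d) set \<Rightarrow> (real^'d) set \<Rightarrow> (real^'d) set \<Rightarrow> real) \<Rightarrow>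
   real \<Rightarrow> nat \<Rightarrow> real \<Rightarrow> (nat \<Rightarrow> (real^'d) set \<Rightarrow> real) \<Rightarrow> (nat \<Rightarrow> (real^'d) set \<Rightarrow> real) \<Rightarrow>
   (nat \<Rightarrow> (real^'d) set \<Rightarrow> real) \<Rightarrow> (nat \<Rightarrow> (real^'d) set \<Rightarrow> real) \<Rightarrow> bool" where
  "mac_scheme G w \<delta>t N \<epsilon>\<^sub>0 \<eta> \<rho> u \<phi> \<longleftrightarrow>
     (\<forall>n\<le>N. \<rho> n \<in> L_M G \<and> u n \<in> H_E0 G \<and> \<phi> n \<in> L_M G) \<and>
     (\<forall>n<N. let F = mass_flux G \<delta>t (\<eta> n) (\<rho> n) (u n) (\<phi> (Suc n)); \<Lambda> = (\<lambda>K. \<delta>t * div_M (u n) K) in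
        eta_condition G (\<rho> n) (\<eta> n) \<and>
        (\<forall>K\<in>cells G.
           1 / \<delta>t * (\<rho> (Suc n) K - \<rho> n K) + 1 / vol K * (\<Sum>\<sigma>\<in>edges_of K. F \<sigma> K) = 0) \<and>
        (\<forall>i. \<forall>\<sigma>\<in>int_edges_dir G i.
           1 / \<delta>t * (dual_average G (\<rho> (Suc n)) \<sigma> * u (Suc n) \<sigma> - dual_average G (\<rho> n) \<sigma> * u n \<sigma>)
           + 1 / vol (dual_cell G \<sigma>)
             * (\<Sum>\<epsilon>\<in>dual_edges G \<sigma>. dual_flux G w F \<epsilon> \<sigma> * upwind G w F (u n) \<epsilon> \<sigma>)
           = - edge_density G (\<rho> n) \<sigma> * grad_E G (\<phi> (Suc n)) \<sigma> + grad_E G \<Lambda> \<sigma>) \<and>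
        (\<forall>K\<in>cells G.
           - \<epsilon>\<^sub>0\<^sup>2 * laplacian_M G (\<phi> (Suc n)) K = \<rho> (Suc n) K - exp (\<phi> (Suc n) K)))"

text \<open>The operator $(\partial^{(i)}_{\mathcal E}\tilde\rho^{n+1})^*$, with \<open>\<rho>\<close>, \<open>\<rho>'\<close> standing for
  $\tilde\rho^n$, $\tilde\rho^{n+1}$ and \<open>U\<close> for $U^n$.\<close>

definition grad_star ::
  "'d::finite mac_mesh \<Rightarrow> real \<Rightarrow> ((real^'d) set \<Rightarrow> real) \<Rightarrow> ((real^'d) set \<Rightarrow> real) \<Rightarrow>
   ((real^'d) set \<Rightarrow> real) \<Rightarrow> (real^'d) set \<Rightarrow> real" where
  "grad_star G \<delta>t \<rho> \<rho>' U \<sigma> =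
     grad_E G \<rho>' \<sigma>
     - (edge_density G \<rho>' \<sigma> - edge_density G \<rho> \<sigma>) * grad_E G (\<lambda>K. ln (\<rho>' K)) \<sigma>
     - \<delta>t * grad_E G (div_M U) \<sigma>"

definition limit_scheme ::
  "'d::finite mac_mesh \<Rightarrow>
   ((real^'d) set \<Rightarrow> (real^'d) set \<Rightarrow> (real^'d) set \<Rightarrow> (real^'d) set \<Rightarrow> real) \<Rightarrow>
   real \<Rightarrow> nat \<Rightarrow> (nat \<Rightarrow> (real^'d) set \<Rightarrow> real) \<Rightarrow> (nat \<Rightarrow> (real^'d) set \<Rightarrow> real) \<Rightarrow>
   (nat \<Rightarrow> (real^'d) set \<Rightarrow> real) \<Rightarrow> bool" where
  "limit_scheme G w \<delta>t N \<eta> \<rho> U \<longleftrightarrow>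
     (\<forall>n<N. let F = mass_flux G \<delta>t (\<eta> n) (\<rho> n) (U n) (\<lambda>K. ln (\<rho> (Suc n) K)) in
        eta_condition G (\<rho> n) (\<eta> n) \<and>
        (\<forall>K\<in>cells G.
           1 / \<delta>t * (\<rho> (Suc n) K - \<rho> n K) + 1 / vol K * (\<Sum>\<sigma>\<in>edges_of K. F \<sigma> K) = 0) \<and>
        (\<forall>i. \<forall>\<sigma>\<in>int_edges_dir G i.
           1 / \<delta>t * (dual_average G (\<rho> (Suc n)) \<sigma> * U (Suc n) \<sigma> - dual_average G (\<rho> n) \<sigma> * U n \<sigma>)
           + 1 / vol (dual_cell G \<sigma>)
             * (\<Sum>\<epsilon>\<in>dual_edges G \<sigma>. dual_flux G w F \<epsilon> \<sigma> * upwind G w F (U n) \<epsilon> \<sigma>)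
           + grad_star G \<delta>t (\<rho> n) (\<rho> (Suc n)) (U n) \<sigma> = 0))"

section \<open>Initial data\<close>

text \<open>Data are functions on the open set \<open>region G\<close>, whence the intersections.\<close>

definition initialised ::
  "'d::finite mac_mesh \<Rightarrow> (real^'d \<Rightarrow> real) \<Rightarrow> (real^'d \<Rightarrow> real^'d) \<Rightarrow> (real^'d \<Rightarrow> real) \<Rightarrow>
   ((real^'d) set \<Rightarrow> real) \<Rightarrow> ((real^'d) set \<Rightarrow> real) \<Rightarrow> ((real^'d) set \<Rightarrow> real) \<Rightarrow> bool" where
  "initialised G \<rho>\<^sub>0 u\<^sub>0 \<phi>\<^sub>0 \<rho> u \<phi> \<longleftrightarrow>
     (\<forall>K\<in>cells G. \<rho> K = 1 / vol K * (LINT x:K \<inter> region G|lebesgue. \<rho>\<^sub>0 x) \<and>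
                   \<phi> K = 1 / vol K * (LINT x:K \<inter> region G|lebesgue. \<phi>\<^sub>0 x)) \<and>
     (\<forall>i. \<forall>\<sigma>\<in>int_edges_dir G i.
        u \<sigma> = 1 / vol (dual_cell G \<sigma>) * (LINT x:dual_cell G \<sigma> \<inter> region G|lebesgue. u\<^sub>0 x $ i))"

definition L_infinity :: "(real^'d::finite) set \<Rightarrow> (real^'d \<Rightarrow> real) set" where
  "L_infinity \<Omega> = {f \<in> borel_measurable (lebesgue_on \<Omega>). \<exists>B. AE x in lebesgue_on \<Omega>. \<bar>f x\<bar> \<le> B}"

definition L_two_vec :: "(real^'d::finite) set \<Rightarrow> (real^'d \<Rightarrow> real^'d) set" where
  "L_two_vec \<Omega> = {f \<in> borel_measurable (lebesgue_on \<Omega>). integrable (lebesgue_on \<Omega>) (\<lambda>x. (norm (f x))\<^sup>2)}"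

definition test_function :: "(real^'d::finite) set \<Rightarrow> (real^'d \<Rightarrow> real) \<Rightarrow> bool" where
  "test_function \<Omega> \<psi> \<longleftrightarrow>
     (\<forall>x. \<psi> differentiable (at x)) \<and>
     (\<forall>i. continuous_on UNIV (\<lambda>x. frechet_derivative \<psi> (at x) (axis i 1))) \<and>
     (\<exists>A. compact A \<and> A \<subseteq> \<Omega> \<and> (\<forall>x. x \<notin> A \<longrightarrow> \<psi> x = 0))"

text \<open>Weak gradient, tested against compactly supported $C^1$ functions.\<close>

definition weak_gradient ::
  "(real^'d::finite) set \<Rightarrow> (real^'d \<Rightarrow> real) \<Rightarrow> (real^'d \<Rightarrow> real^'d) \<Rightarrow> bool" where
  "weak_gradient \<Omega> f g \<longleftrightarrow>
     (\<forall>\<psi> i. test_function \<Omega> \<psi> \<longrightarrow>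
        (LINT x|lebesgue_on \<Omega>. f x * frechet_derivative \<psi> (at x) (axis i 1))
        = - (LINT x|lebesgue_on \<Omega>. g x $ i * \<psi> x))"

text \<open>The energy bound forces $\nabla\phi_0^\varepsilon \in L^2(\Omega)^d$; this is stated explicitly because the
  Bochner integral of a non-integrable function is 0.  The other terms are integrable.\<close>

definition well_prepared ::
  "(real^'d::finite) set \<Rightarrow> (real \<Rightarrow> real^'d \<Rightarrow> real) \<Rightarrow> (real \<Rightarrow> real^'d \<Rightarrow> real^'d) \<Rightarrow>
   (real \<Rightarrow> real^'d \<Rightarrow> real) \<Rightarrow> bool" where
  "well_prepared \<Omega> \<rho>\<^sub>0 u\<^sub>0 \<phi>\<^sub>0 \<longleftrightarrow>
     (\<forall>\<epsilon>>0. \<rho>\<^sub>0 \<epsilon> \<in> L_infinity \<Omega> \<and> (AE x in lebesgue_on \<Omega>. \<rho>\<^sub>0 \<epsilon> x > 0) \<and>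
            u\<^sub>0 \<epsilon> \<in> L_two_vec \<Omega> \<and> \<phi>\<^sub>0 \<epsilon> \<in> L_infinity \<Omega>) \<and>
     (\<exists>C>0. \<exists>\<rho>l \<in> L_infinity \<Omega>. (AE x in lebesgue_on \<Omega>. \<rho>l x > 0) \<and>
        ((\<lambda>\<epsilon>. LINT x|lebesgue_on \<Omega>. (\<rho>\<^sub>0 \<epsilon> x - \<rho>l x)\<^sup>2) \<longlongrightarrow> 0) (at_right 0) \<and>
        (\<forall>\<epsilon>>0. \<exists>g \<in> L_two_vec \<Omega>. weak_gradient \<Omega> (\<phi>\<^sub>0 \<epsilon>) g \<and>
           (LINT x|lebesgue_on \<Omega>. \<epsilon>\<^sup>2 / 2 * (norm (g x))\<^sup>2 + (\<phi>\<^sub>0 \<epsilon> x - 1) * exp (\<phi>\<^sub>0 \<epsilon> x)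
                                  + 1 / 2 * \<rho>\<^sub>0 \<epsilon> x * (norm (u\<^sub>0 \<epsilon> x))\<^sup>2) \<le> C))"

section \<open>Convergence in any discrete norm\<close>

text \<open>A function which is piecewise constant in space and time is an array of values indexed by a
  finite set \<open>I\<close> of pairs (time index, cell or edge); arrays are extended by zero outside \<open>I\<close>.\<close>

definition arrays :: "'k set \<Rightarrow> ('k \<Rightarrow> real) set" where
  "arrays I = {f. \<forall>k. k \<notin> I \<longrightarrow> f k = 0}"

definition discrete_norm :: "'k set \<Rightarrow> (('k \<Rightarrow> real) \<Rightarrow> real) \<Rightarrow> bool" where
  "discrete_norm I \<N> \<longleftrightarrow>
     (\<forall>f\<in>arrays I. \<N> f \<ge> 0 \<and> (\<N> f = 0 \<longleftrightarrow> f = (\<lambda>_. 0)) \<and> (\<forall>c. \<N> (\<lambda>k. c * f k) = \<bar>c\<bar> * \<N> f)) \<and>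
     (\<forall>f\<in>arrays I. \<forall>g\<in>arrays I. \<N> (\<lambda>k. f k + g k) \<le> \<N> f + \<N> g)"

definition tends_in_any_discrete_norm ::
  "(nat \<times> 'c) set \<Rightarrow> (nat \<Rightarrow> nat \<Rightarrow> 'c \<Rightarrow> real) \<Rightarrow> (nat \<Rightarrow> 'c \<Rightarrow> real) \<Rightarrow> bool" where
  "tends_in_any_discrete_norm I f g \<longleftrightarrow>
     (\<forall>\<N>. discrete_norm I \<N> \<longrightarrow>
        (\<lambda>m. \<N> (\<lambda>(n, k). if (n, k) \<in> I then f m n k - g n k else 0)) \<longlonglongrightarrow> 0)"

end

theory Submission
  imports Defs
begin

text \<open>On a fixed mesh a discrete solution is a finite list of numbers, so the theorem is a
compactness statement in finite dimension, and $\varepsilon$ enters the scheme only through the term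
$\varepsilon^2 \Delta_{\mathcal M}\phi$ of the Poisson equation.

The densities and the stabilisation parameters are bounded by hypothesis. The potentials are bounded
uniformly in $\varepsilon$ by the discrete maximum principle
(\<open>poisson_maximum_principle\<close>). It rests on the geometric fact that an internal edge
separates exactly two cells and has opposite normals with respect to them, which is derived here
from the description of the facets of a box. The initial velocities are bounded by the energy of the
well-prepared data (\<open>initial_velocities_bounded\<close>). Hence all these finitely many
sequences converge along a common subsequence (\<open>simultaneous_convergent_subsequence\<close>).
In the Poisson equation $\varepsilon^2 \Delta_{\mathcal M}\phi$ then tends to 0, so the limit of the
potential is the logarithm of the limit density.

The later velocities need no a priori bound. The scheme is explicit in the velocity, and the
averaged density by which one divides has a positive limit; so, by induction on the time level, the
velocities converge along the same subsequence.

It remains to pass to the limit in the equations. All the terms are continuous functions of the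
unknowns; this is not obvious only for the logarithmic mean on the diagonal
(\<open>tendsto_log_mean\<close>) and for the upwind momentum flux where the mass flux changes sign
(\<open>tendsto_upwind_flux\<close>). Finally the limit of the electric force takes the form of
\<open>grad_star\<close> because of the identity $\rho_\sigma\,\partial \ln\rho = \partial\rho$ for
the logarithmic mean (\<open>edge_density_times_grad_ln\<close>). Convergence in every discrete norm
follows from convergence of all the entries
(\<open>tends_in_any_discrete_norm_if_pointwise\<close>).\<close>

section \<open>Faces of boxes\<close>

text \<open>The value \<open>s = 1\<close> gives the upper and \<open>s = -1\<close> the lower face
of the box in direction \<open>i\<close>, so that \<open>s\<close> is the number $e^{(i)} \cdot \nu$
of that face.\<close>

definition box_face :: "real^'d \<Rightarrow> real^'d \<Rightarrow> 'd \<Rightarrow> real \<Rightarrow> (real^'d::finite) set" where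
  "box_face a b i s = {x \<in> cbox a b. x $ i = (a $ i + b $ i) / 2 + s * ((b $ i - a $ i) / 2)}"

text \<open>The value \<open>s = 0\<close> gives the centre of the box and \<open>s =
\<plusminus>1/2\<close> a point of the open half of the box adjacent to a face.\<close>

definition face_centre :: "real^'d \<Rightarrow> real^'d \<Rightarrow> 'd \<Rightarrow> real \<Rightarrow> real^'d::finite" where
  "face_centre a b i s = (\<chi> j. (a $ j + b $ j) / 2 + (if j = i then s * ((b $ j - a $ j) / 2) else 0))"

lemma shifted_face_centre_in_box_face:
  fixes a b :: "real^'d::finite"
  assumes "\<And>j. a $ j < b $ j" "s = 1 \<or> s = -1" "j \<noteq> i" "\<bar>t\<bar> \<le> (b $ j - a $ j) / 2"
  shows "face_centre a b i s + t *\<^sub>R axis j 1 \<in> box_face a b i s"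
proof -
  have "a $ k \<le> (face_centre a b i s + t *\<^sub>R axis j 1) $ k
        \<and> (face_centre a b i s + t *\<^sub>R axis j 1) $ k \<le> b $ k" for k
    using assms(1)[of k] assms(2-4) unfolding face_centre_def axis_def
    by (auto simp: field_simps abs_le_iff)
  then show ?thesis using assms(3) unfolding box_face_def mem_box_cart
    by (simp add: mem_box_cart face_centre_def axis_def)
qed

lemma face_centre_in_box_face:
  fixes a b :: "real^'d::finite"
  assumes "\<And>j. a $ j < b $ j" "s = 1 \<or> s = -1"
  shows "face_centre a b i s \<in> box_face a b i s"
proof -
  have "a $ k \<le> face_centre a b i s $ k \<and> face_centre a b i s $ k \<le> b $ k" for k
    using assms(1)[of k] assms(2) unfolding face_centre_def
    by (auto simp: field_simps)
  then show ?thesis unfolding box_face_def mem_box_cart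
    by (simp add: mem_box_cart face_centre_def)
qed

text \<open>A facet is the set where a nonzero linear functional $\alpha$ is maximal on the box. If
$\alpha_i \ne 0$, then a maximiser must have an extremal $i$-th coordinate, since otherwise a move
along $e^{(i)}$ would increase $\alpha$. So the facet lies in a face of the form \<open>box_face a b
i s\<close>, which is proper, and a facet is contained in no other proper face.\<close>

lemma facet_of_cbox_is_box_face:
  fixes a b :: "real^'d::finite"
  assumes ab: "\<And>j. a $ j < b $ j" and facet: "\<sigma> facet_of cbox a b"
  obtains i s where "s = 1 \<or> s = -1" "\<sigma> = box_face a b i s"
proof -
  obtain \<alpha> \<beta> where \<alpha>: "\<alpha> \<noteq> 0" and le: "cbox a b \<subseteq> {x. \<alpha> \<bullet> x \<le> \<beta>}"
    and \<sigma>: "\<sigma> = cbox a b \<inter> {x. \<alpha> \<bullet> x = \<beta>}"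
    using facet_of_polyhedron[OF polytope_imp_polyhedron[OF polytope_interval] facet] by metis
  obtain i where i: "\<alpha> $ i \<noteq> 0" using \<alpha> by (metis vec_eq_iff zero_index)
  define s where "s = sgn (\<alpha> $ i)"
  have s: "s = 1 \<or> s = -1" using i by (auto simp: s_def sgn_if)
  have \<alpha>s: "\<alpha> $ i * s > 0" using i by (auto simp: s_def sgn_if)
  have sub: "\<sigma> \<subseteq> box_face a b i s"
  proof
    fix x assume x: "x \<in> \<sigma>"
    define c where "c = (a $ i + b $ i) / 2 + s * ((b $ i - a $ i) / 2)"
    have xb: "\<And>k. a $ k \<le> x $ k \<and> x $ k \<le> b $ k" using x by (simp add: \<sigma> mem_box_cart)
    have c: "a $ i \<le> c" "c \<le> b $ i" using s ab[of i] by (auto simp: c_def field_simps)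
    define y where "y = x + (c - x $ i) *\<^sub>R axis i 1"
    have "y \<in> cbox a b" using xb c by (auto simp: mem_box_cart y_def axis_def)
    then have "\<alpha> \<bullet> y \<le> \<beta>" using le by auto
    moreover have "\<alpha> \<bullet> x = \<beta>" using x by (simp add: \<sigma>)
    ultimately have "(c - x $ i) * (\<alpha> $ i) \<le> 0"
      by (simp add: y_def inner_right_distrib inner_axis)
    moreover have "s * (c - x $ i) \<ge> 0"
      using s xb[of i] by (auto simp: c_def field_simps)
    ultimately have "c = x $ i" using s \<alpha>s
      by (auto simp: mult_le_0_iff)
    then show "x \<in> box_face a b i s" using x by (simp add: box_face_def \<sigma> c_def)
  qed
  have face: "box_face a b i s face_of cbox a b"
  proof -
    have eq: "box_face a b i s = cbox a b \<inter> {x. (s *\<^sub>R axis i 1) \<bullet> x = s * ((a $ i + b $ i) / 2 + s * ((b $ i - a $ i) / 2))}"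
      using s by (auto simp: box_face_def inner_axis')
    show ?thesis unfolding eq
      by (rule face_of_Int_supporting_hyperplane_le)
         (use s in \<open>auto simp: inner_axis' mem_box_cart field_simps\<close>)
  qed
  have ne: "box_face a b i s \<noteq> cbox a b"
  proof
    assume eq: "box_face a b i s = cbox a b"
    have "a \<in> box_face a b i s" "b \<in> box_face a b i s"
      unfolding eq by (auto simp: mem_box_cart intro: less_imp_le[OF ab])
    then show False using ab[of i] by (simp add: box_face_def)
  qed
  have "\<sigma> = box_face a b i s"
  proof (rule ccontr)
    assume neq: "\<sigma> \<noteq> box_face a b i s"
    have "\<sigma> face_of box_face a b i s"
      using face_of_subset[OF facet_of_imp_face_of[OF facet] sub] face_of_imp_subset[OF face] by blast
    then have "aff_dim \<sigma> < aff_dim (box_face a b i s)"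
      using face_of_aff_dim_lt[OF face_of_imp_convex[OF face]] neq by auto
    moreover have "aff_dim (box_face a b i s) < aff_dim (cbox a b)"
      using face_of_aff_dim_lt[OF convex_box(1) face] ne by auto
    moreover have "aff_dim \<sigma> = aff_dim (cbox a b) - 1" using facet by (simp add: facet_of_def)
    ultimately show False by simp
  qed
  then show thesis using that s by blast
qed

text \<open>Uniqueness holds because a face of a nondegenerate box contains two points which differ
in any other coordinate.\<close>

lemma orthogonal_to_axis_box_face_iff:
  fixes a b :: "real^'d::finite"
  assumes ab: "\<And>j. a $ j < b $ j" and s: "s = 1 \<or> s = -1"
  shows "orthogonal_to_axis j (box_face a b i s) \<longleftrightarrow> j = i"
proof
  assume "orthogonal_to_axis j (box_face a b i s)"
  then obtain c where c: "\<And>x. x \<in> box_face a b i s \<Longrightarrow> x $ j = c"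
    unfolding orthogonal_to_axis_def by auto
  show "j = i"
  proof (rule ccontr)
    assume "j \<noteq> i"
    then show False
      using c[OF face_centre_in_box_face[OF ab s]] ab[of j]
        c[OF shifted_face_centre_in_box_face[OF ab s \<open>j \<noteq> i\<close>, of "(b $ j - a $ j) / 2"]]
      by (auto simp: axis_def)
  qed
qed (auto simp: orthogonal_to_axis_def box_face_def)

lemma edge_dir_box_face:
  fixes a b :: "real^'d::finite"
  assumes ab: "\<And>j. a $ j < b $ j" and s: "s = 1 \<or> s = -1"
  shows "edge_dir (box_face a b i s) = i"
  unfolding edge_dir_def orthogonal_to_axis_box_face_iff[OF assms] by simp

text \<open>Moving from the centre of the face in both senses along $e^{(j)}$, $j \ne i$, shows that
a vector with the defining property has no component in these directions; moving to the centre of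
the box determines the sign of the remaining one.\<close>

lemma outward_normal_box_face:
  fixes a b :: "real^'d::finite"
  assumes ab: "\<And>j. a $ j < b $ j" and s: "s = 1 \<or> s = -1"
  shows "outward_normal (box_face a b i s) (cbox a b) = s *\<^sub>R axis i 1"
  unfolding outward_normal_def
proof (rule the_equality)
  show "norm (s *\<^sub>R axis i (1::real)) = 1 \<and>
    (\<forall>x\<in>box_face a b i s. \<forall>y\<in>cbox a b. s *\<^sub>R axis i 1 \<bullet> (y - x) \<le> 0)"
    using s by (auto simp: norm_axis_1 inner_axis' box_face_def mem_box_cart field_simps)
next
  fix \<nu> :: "real^'d"
  assume \<nu>: "norm \<nu> = 1 \<and> (\<forall>x\<in>box_face a b i s. \<forall>y\<in>cbox a b. \<nu> \<bullet> (y - x) \<le> 0)"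
  have sub: "box_face a b i s \<subseteq> cbox a b" by (auto simp: box_face_def)
  have cF: "face_centre a b i s \<in> box_face a b i s"
    by (rule face_centre_in_box_face[OF ab s])
  have "\<nu> $ j = 0" if "j \<noteq> i" for j
  proof -
    define t where "t = (b $ j - a $ j) / 2"
    have t: "t > 0" using ab[of j] by (simp add: t_def)
    have "face_centre a b i s + t *\<^sub>R axis j 1 \<in> cbox a b"
         "face_centre a b i s + (- t) *\<^sub>R axis j 1 \<in> cbox a b"
      using shifted_face_centre_in_box_face[OF ab s that, of t]
        shifted_face_centre_in_box_face[OF ab s that, of "- t"] t sub by (auto simp: t_def)
    then have "\<nu> \<bullet> (t *\<^sub>R axis j 1) \<le> 0" "\<nu> \<bullet> ((- t) *\<^sub>R axis j 1) \<le> 0"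
      using \<nu> cF by (metis add_diff_cancel_left')+
    then show ?thesis using t by (simp add: inner_axis mult_le_0_iff zero_le_mult_iff)
  qed
  then have eq: "\<nu> = (\<nu> $ i) *\<^sub>R axis i 1" by (auto simp: vec_eq_iff axis_def)
  then have "\<bar>\<nu> $ i\<bar> = 1" using \<nu> by (metis mult.right_neutral norm_axis_1 norm_scaleR)
  moreover have "s * \<nu> $ i \<ge> 0"
  proof -
    \<comment> \<open>Test with the centre of the box.\<close>
    define m where "m = face_centre a b i 0"
    have "m \<in> cbox a b"
      using ab by (auto simp: m_def face_centre_def mem_box_cart field_simps less_imp_le)
    then have "\<nu> \<bullet> (m - face_centre a b i s) \<le> 0" using \<nu> cF by blast
    moreover have "m - face_centre a b i s = (- s * ((b $ i - a $ i) / 2)) *\<^sub>R axis i 1"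
      by (auto simp: m_def face_centre_def vec_eq_iff axis_def)
    ultimately have "(s * \<nu> $ i) * ((b $ i - a $ i) / 2) \<ge> 0" by (simp add: inner_axis algebra_simps)
    then show ?thesis using ab[of i] by (simp add: zero_le_mult_iff)
  qed
  ultimately have "\<nu> $ i = s" using s by auto
  then show "\<nu> = s *\<^sub>R axis i 1" using eq by simp
qed

lemma edge_sign_box_face:
  fixes a b :: "real^'d::finite"
  assumes ab: "\<And>j. a $ j < b $ j" and s: "s = 1 \<or> s = -1"
  shows "edge_sign (box_face a b i s) (cbox a b) = s"
  unfolding edge_sign_def edge_dir_box_face[OF assms] outward_normal_box_face[OF assms]
  by (simp add: inner_axis_axis)

text \<open>Two cells cannot lie on the same side of a common face: a point obtained from the centre
of the face by a small displacement into the cells is interior to both boxes. This fact about boxes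
is the reason why an internal edge separates exactly two cells, with opposite normals.\<close>

lemma boxes_on_the_same_side_overlap:
  fixes a b a' b' :: "real^'d::finite"
  assumes ab: "\<And>j. a $ j < b $ j" and ab': "\<And>j. a' $ j < b' $ j" and s: "s = 1 \<or> s = -1"
    and eq: "box_face a b i s = box_face a' b' i s"
  shows "interior (cbox a b) \<inter> interior (cbox a' b') \<noteq> {}"
proof -
  let ?c = "face_centre a b i s"
  define t where "t = min (b $ i - a $ i) (b' $ i - a' $ i) / 2"
  have t: "t > 0" "t < b $ i - a $ i" "t < b' $ i - a' $ i"
    using ab[of i] ab'[of i] by (auto simp: t_def min_def)
  define p where "p = ?c - (s * t) *\<^sub>R axis i 1"
  have level: "?c $ i = (a' $ i + b' $ i) / 2 + s * ((b' $ i - a' $ i) / 2)"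
    using face_centre_in_box_face[OF ab s, of i] unfolding eq by (simp add: box_face_def)
  have mid: "a' $ j < ?c $ j \<and> ?c $ j < b' $ j" if "j \<noteq> i" for j
  proof -
    let ?t = "(b $ j - a $ j) / 2"
    have "?c + ?t *\<^sub>R axis j 1 \<in> cbox a' b'" "?c + (- ?t) *\<^sub>R axis j 1 \<in> cbox a' b'"
      using shifted_face_centre_in_box_face[OF ab s that, of ?t]
        shifted_face_centre_in_box_face[OF ab s that, of "- ?t"] ab[of j]
      unfolding eq by (auto simp: box_face_def)
    then have "(?c + ?t *\<^sub>R axis j 1) $ j \<le> b' $ j" "a' $ j \<le> (?c + (- ?t) *\<^sub>R axis j 1) $ j"
      by (auto simp only: mem_box_cart)
    then have "?c $ j + ?t \<le> b' $ j" "a' $ j \<le> ?c $ j - ?t" by (simp_all add: axis_def)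
    then show ?thesis using ab[of j] by (auto simp: field_simps)
  qed
  have "p \<in> box a b"
    unfolding mem_box_cart using t s ab
    by (auto simp: p_def face_centre_def axis_def field_simps)
  moreover have "a' $ j < p $ j \<and> p $ j < b' $ j" for j
  proof (cases "j = i")
    case True
    then show ?thesis using level t s by (auto simp: p_def axis_def field_simps)
  next
    case False
    then show ?thesis using mid by (simp add: p_def axis_def)
  qed
  then have "p \<in> box a' b'" by (simp add: mem_box_cart)
  ultimately show ?thesis by (auto simp: interior_cbox)
qed

lemma half_cell_box_face:
  fixes a b :: "real^'d::finite"
  assumes ab: "\<And>j. a $ j < b $ j" and s: "s = 1 \<or> s = -1"
  shows "half_cell (box_face a b i s) (cbox a b) =
    {x \<in> cbox a b. \<bar>x $ i - face_centre a b i s $ i\<bar> \<le> (b $ i - a $ i) / 2}"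
proof -
  have ne: "cbox a b \<noteq> {}" using ab by (simp add: interval_ne_empty_cart less_imp_le)
  have bds: "interval_upperbound (cbox a b) = b" "interval_lowerbound (cbox a b) = a"
    using ne by (simp_all add: box_ne_empty)
  have "(\<forall>y\<in>box_face a b i s. P (y $ i)) \<longleftrightarrow> P (face_centre a b i s $ i)" for P
    using face_centre_in_box_face[OF assms, of i] by (force simp: box_face_def face_centre_def)
  then show ?thesis
    unfolding half_cell_def edge_dir_box_face[OF assms] Let_def bds
    by (intro Collect_cong conj_cong refl)
qed

text \<open>The half cell contains a nonempty open set, namely the points of the open box which are
closer to the face than half the width.\<close>

lemma half_cell_compact_and_positive:
  fixes a b :: "real^'d::finite"
  assumes ab: "\<And>j. a $ j < b $ j" and s: "s = 1 \<or> s = -1"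
  shows "compact (half_cell (box_face a b i s) (cbox a b))"
    and "vol (half_cell (box_face a b i s) (cbox a b)) > 0"
proof -
  let ?c = "face_centre a b i s $ i" and ?h = "(b $ i - a $ i) / 2"
  let ?H = "half_cell (box_face a b i s) (cbox a b)"
  have "?H = cbox a b \<inter> {x. \<bar>x $ i - ?c\<bar> \<le> ?h}"
    unfolding half_cell_box_face[OF assms] by auto
  moreover have "closed {x::real^'d. \<bar>x $ i - ?c\<bar> \<le> ?h}"
    by (intro closed_Collect_le continuous_intros)
  ultimately show c: "compact ?H" by (metis compact_Int_closed compact_cbox)
  define P where "P = box a b \<inter> {x. \<bar>x $ i - ?c\<bar> < ?h}"
  have "open P" unfolding P_def by (intro open_Int open_box open_Collect_less continuous_intros)
  moreover have "face_centre a b i (s / 2) \<in> P"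
    using s ab ab[of i] by (auto simp: P_def mem_box_cart face_centre_def field_simps abs_if)
  ultimately have "\<not> negligible P" using open_not_negligible by blast
  moreover have "P \<subseteq> ?H" unfolding half_cell_box_face[OF assms] P_def by (auto simp: mem_box_cart less_imp_le)
  ultimately have "\<not> negligible ?H" using negligible_subset by blast
  then have "measure lebesgue ?H \<noteq> 0"
    using negligible_iff_measure0[OF lmeasurable_compact[OF c]] by simp
  then show "vol ?H > 0" by (simp add: zero_less_measure_iff)
qed

section \<open>Edges and dual cells of a MAC grid\<close>

lemma cell_is_box:
  assumes "mac_grid G" "K \<in> cells G"
  obtains a b where "K = cbox a b" "\<forall>j. a $ j < b $ j"
proof -
  obtain a b where K: "K = cbox a b"
    using assms unfolding mac_grid_def by (meson division_ofD(4))
  then have "box a b \<noteq> {}" using assms unfolding mac_grid_def by auto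
  then show thesis using K that by (simp add: interval_ne_empty_cart)
qed

lemma finite_cells: "mac_grid G \<Longrightarrow> finite (cells G)"
  unfolding mac_grid_def by (meson division_ofD(1))

lemma finite_edges:
  assumes "mac_grid G" shows "finite (edges G)"
  unfolding edges_def
proof (rule finite_UN_I)
  fix K assume "K \<in> cells G"
  then obtain a b where "K = cbox a b" using cell_is_box[OF assms] by blast
  then show "finite (edges_of K)"
    by (simp add: edges_of_def finite_polytope_facets polytope_interval)
qed (rule finite_cells[OF assms])

lemma finite_int_edges: "mac_grid G \<Longrightarrow> finite (int_edges G)"
  using finite_edges unfolding int_edges_def by blast

lemma edge_is_box_face:
  assumes "mac_grid G" "K \<in> cells G" "\<sigma> \<in> edges_of K"
  obtains a b i s where "K = cbox a b" "\<forall>j. a $ j < b $ j" "s = 1 \<or> s = -1" "\<sigma> = box_face a b i s"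
proof -
  obtain a b where K: "K = cbox a b" "\<forall>j. a $ j < b $ j"
    using cell_is_box[OF assms(1,2)] by blast
  moreover obtain i s where "s = 1 \<or> s = -1" "\<sigma> = box_face a b i s"
    using facet_of_cbox_is_box_face[of a b \<sigma>] K assms(3) unfolding edges_of_def by blast
  ultimately show thesis using that by blast
qed

lemma edge_sign_cases:
  assumes "mac_grid G" "K \<in> cells G" "\<sigma> \<in> edges_of K"
  shows "edge_sign \<sigma> K = 1 \<or> edge_sign \<sigma> K = -1"
proof -
  obtain a b i s where "K = cbox a b" "\<forall>j. a $ j < b $ j" "s = 1 \<or> s = -1" "\<sigma> = box_face a b i s"
    by (rule edge_is_box_face[OF assms])
  then show ?thesis using edge_sign_box_face[of a b s i] by auto
qed

lemma cells_on_the_same_side_equal: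
  assumes G: "mac_grid G" and K: "K \<in> cells G" "\<sigma> \<in> edges_of K"
    and L: "L \<in> cells G" "\<sigma> \<in> edges_of L" and eq: "edge_sign \<sigma> K = edge_sign \<sigma> L"
  shows "K = L"
proof -
  obtain a b i s where k: "K = cbox a b" "\<forall>j. a $ j < b $ j" "s = 1 \<or> s = -1" "\<sigma> = box_face a b i s"
    by (rule edge_is_box_face[OF G K])
  obtain a' b' i' s' where l: "L = cbox a' b'" "\<forall>j. a' $ j < b' $ j" "s' = 1 \<or> s' = -1"
    "\<sigma> = box_face a' b' i' s'"
    by (rule edge_is_box_face[OF G L])
  have "i = i'" using edge_dir_box_face[OF k(2)[rule_format] k(3)] edge_dir_box_face[OF l(2)[rule_format] l(3)] k(4) l(4) by metis
  moreover have "s = s'"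
    using edge_sign_box_face[OF k(2)[rule_format] k(3)] edge_sign_box_face[OF l(2)[rule_format] l(3)] eq k(1,4) l(1,4) by metis
  ultimately have "interior K \<inter> interior L \<noteq> {}"
    using boxes_on_the_same_side_overlap[OF k(2)[rule_format] l(2)[rule_format] k(3), of i] k(1,4) l(1,4) by simp
  then show ?thesis using G K(1) L(1) division_ofD(5) unfolding mac_grid_def by metis
qed

lemma adjacent_cells_interface:
  assumes "mac_grid G" "\<sigma> \<in> int_edges G" "adjacent_cells G \<sigma> = (K, L)"
  shows "interface G K L \<sigma>"
proof -
  have "\<exists>p. case p of (K, L) \<Rightarrow> interface G K L \<sigma>"
    using assms(1,2) unfolding mac_grid_def by auto
  then have "case adjacent_cells G \<sigma> of (K, L) \<Rightarrow> interface G K L \<sigma>"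
    unfolding adjacent_cells_def by (rule someI_ex)
  then show ?thesis using assms(3) by simp
qed

text \<open>An internal edge is a facet of some cell, hence has dimension $d-1$, and conformity of
the grid applies to the two cells of which it is the intersection.\<close>

lemma interface_edges_of:
  fixes G :: "'d::finite mac_mesh"
  assumes G: "mac_grid G" and int: "interface G K L \<sigma>"
  shows "\<sigma> \<in> edges_of K" "\<sigma> \<in> edges_of L"
proof -
  have \<sigma>: "\<sigma> = K \<inter> L" "K \<in> cells G" "L \<in> cells G" "K \<noteq> L" using int by (auto simp: interface_def)
  obtain M where M: "M \<in> cells G" "\<sigma> facet_of M"
    using int unfolding interface_def int_edges_def edges_def edges_of_def by auto
  then have "interior M \<noteq> {}" using G unfolding mac_grid_def by blast
  then have "aff_dim \<sigma> = int CARD('d) - 1"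
    using M aff_dim_nonempty_interior[of M] by (simp add: facet_of_def)
  then have "K \<inter> L \<in> edges_of K \<and> K \<inter> L \<in> edges_of L"
    using G \<sigma> unfolding mac_grid_def by blast
  then show "\<sigma> \<in> edges_of K" "\<sigma> \<in> edges_of L" using \<sigma>(1) by auto
qed

lemma interface_edge_sign:
  assumes G: "mac_grid G" and int: "interface G K L \<sigma>"
  shows "edge_sign \<sigma> L = - edge_sign \<sigma> K"
  using cells_on_the_same_side_equal[OF G, of K \<sigma> L] interface_edges_of[OF assms]
    edge_sign_cases[OF G, of K \<sigma>] edge_sign_cases[OF G, of L \<sigma>] int
  unfolding interface_def by auto

text \<open>Among three cells with a common edge two would have the same sign, hence would
coincide.\<close>

lemma cell_of_interface:
  assumes G: "mac_grid G" and int: "interface G K L \<sigma>" and M: "M \<in> cells G" "\<sigma> \<in> edges_of M"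
  shows "M = K \<or> M = L"
  using cells_on_the_same_side_equal[OF G M, of K] cells_on_the_same_side_equal[OF G M, of L]
    interface_edges_of[OF G int] interface_edge_sign[OF G int]
    edge_sign_cases[OF G M] edge_sign_cases[OF G, of K \<sigma>] int
  unfolding interface_def by auto

lemma int_edge_direction:
  assumes G: "mac_grid G" and "\<sigma> \<in> int_edges G"
  obtains i where "\<sigma> \<in> int_edges_dir G i"
proof -
  obtain K where K: "K \<in> cells G" "\<sigma> \<in> edges_of K"
    using assms(2) unfolding int_edges_def edges_def by auto
  obtain a b i s where "K = cbox a b"
    and k: "\<forall>j. a $ j < b $ j" "s = 1 \<or> s = -1" "\<sigma> = box_face a b i s"
    by (rule edge_is_box_face[OF G K])
  have "orthogonal_to_axis i \<sigma>"
    using orthogonal_to_axis_box_face_iff[OF k(1)[rule_format] k(2), where j=i and i=i] k(3) by simp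
  then show thesis using that assms(2) unfolding int_edges_dir_def by blast
qed

lemma vol_half_cell_pos:
  assumes G: "mac_grid G" and K: "K \<in> cells G" "\<sigma> \<in> edges_of K"
  shows "compact (half_cell \<sigma> K)" "vol (half_cell \<sigma> K) > 0"
proof -
  obtain a b i s where "K = cbox a b" "\<forall>j. a $ j < b $ j" "s = 1 \<or> s = -1" "\<sigma> = box_face a b i s"
    by (rule edge_is_box_face[OF assms])
  then show "compact (half_cell \<sigma> K)" "vol (half_cell \<sigma> K) > 0"
    using half_cell_compact_and_positive[of a b s i] by simp_all
qed

lemma vol_dual_cell_pos:
  assumes G: "mac_grid G" and \<sigma>: "\<sigma> \<in> int_edges G"
  shows "vol (dual_cell G \<sigma>) > 0"
proof -
  let ?S = "{K \<in> cells G. \<sigma> \<in> edges_of K}"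
  obtain K where K: "K \<in> ?S" using \<sigma> unfolding int_edges_def edges_def by auto
  have "compact (dual_cell G \<sigma>)"
    unfolding dual_cell_def using finite_cells[OF G] vol_half_cell_pos(1)[OF G]
    by (intro compact_UN) auto
  moreover have "half_cell \<sigma> K \<subseteq> dual_cell G \<sigma>" using K unfolding dual_cell_def by auto
  ultimately have "vol (half_cell \<sigma> K) \<le> vol (dual_cell G \<sigma>)"
    using K vol_half_cell_pos(1)[OF G]
    by (intro measure_mono_fmeasurable lmeasurable_compact) (auto intro!: fmeasurableD[OF lmeasurable_compact])
  then show ?thesis using vol_half_cell_pos(2)[OF G] K by fastforce
qed

lemma dual_average_pos:
  assumes G: "mac_grid G" and \<sigma>: "\<sigma> \<in> int_edges G" and q: "\<And>K. K \<in> cells G \<Longrightarrow> q K > 0"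
  shows "dual_average G q \<sigma> > 0"
proof -
  obtain K L where KL: "adjacent_cells G \<sigma> = (K, L)" by fastforce
  then have int: "interface G K L \<sigma>" by (rule adjacent_cells_interface[OF G \<sigma>])
  then have "K \<in> cells G" "L \<in> cells G" by (auto simp: interface_def)
  then show ?thesis
    unfolding dual_average_def KL using interface_edges_of[OF G int] vol_half_cell_pos(2)[OF G]
      vol_dual_cell_pos[OF G \<sigma>] q by (auto intro!: divide_pos_pos add_pos_pos)
qed

section \<open>The discrete maximum principle\<close>

text \<open>Each edge $\sigma = K|L$ contributes a nonnegative multiple of $q_L - q_K$ to
$(\Delta_{\mathcal M} q)_K$: the edge measure enters through its square, and if the order of the two
cells used in the gradient is $(L, K)$, then the two signs multiply to $-1$, which compensates for
the sign of the difference.\<close>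

lemma laplacian_nonpos_at_maximum:
  assumes G: "mac_grid G" and K: "K \<in> cells G" and max: "\<And>L. L \<in> cells G \<Longrightarrow> q L \<le> q K"
  shows "laplacian_M G q K \<le> 0"
proof -
  have "edge_measure \<sigma> * (grad_E G q \<sigma> * edge_sign \<sigma> K) \<le> 0" if \<sigma>: "\<sigma> \<in> edges_of K" for \<sigma>
  proof (cases "\<sigma> \<in> int_edges G")
    case True
    obtain A B where AB: "adjacent_cells G \<sigma> = (A, B)" by fastforce
    then have int: "interface G A B \<sigma>" by (rule adjacent_cells_interface[OF G True])
    then have cells: "A \<in> cells G" "B \<in> cells G" by (auto simp: interface_def)
    have D: "vol (dual_cell G \<sigma>) > 0" by (rule vol_dual_cell_pos[OF G True])
    have "edge_measure \<sigma> * (grad_E G q \<sigma> * edge_sign \<sigma> K)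
      = (edge_measure \<sigma>)\<^sup>2 / vol (dual_cell G \<sigma>) * ((q B - q A) * (edge_sign \<sigma> A * edge_sign \<sigma> K))"
      using True by (simp add: grad_E_def AB power2_eq_square)
    moreover have "(q B - q A) * (edge_sign \<sigma> A * edge_sign \<sigma> K) \<le> 0"
      using cell_of_interface[OF G int K \<sigma>] edge_sign_cases[OF G K \<sigma>]
        interface_edge_sign[OF G int] max[OF cells(1)] max[OF cells(2)] by auto
    ultimately show ?thesis using D by (simp add: mult_nonneg_nonpos divide_nonpos_pos)
  qed (simp add: grad_E_def)
  then have "(\<Sum>\<sigma>\<in>edges_of K. edge_measure \<sigma> * (grad_E G q \<sigma> * edge_sign \<sigma> K)) \<le> 0"
    by (rule sum_nonpos)
  then show ?thesis unfolding laplacian_M_def div_M_def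
    by (rule mult_nonneg_nonpos[rotated]) simp
qed

lemma laplacian_minus: "laplacian_M G (\<lambda>K. - q K) K = - laplacian_M G q K"
proof -
  have "grad_E G (\<lambda>K. - q K) = (\<lambda>\<sigma>. - grad_E G q \<sigma>)"
    by (rule ext) (auto simp: grad_E_def diff_divide_distrib algebra_simps split: prod.split)
  then show ?thesis unfolding laplacian_M_def div_M_def
    by (simp add: sum_negf)
qed

text \<open>At a maximum of \<open>q\<close> the Laplacian is nonpositive, so $e^q = \rho +
\varepsilon^2 \Delta_{\mathcal M} q \le \rho$ there; the reverse inequality holds at a minimum. The
bounds do not involve $\varepsilon$, which makes them useful in the limit $\varepsilon \to
0$.\<close>

lemma poisson_maximum_principle:
  assumes G: "mac_grid G" and c: "0 < c"
    and eq: "\<And>K. K \<in> cells G \<Longrightarrow> - e\<^sup>2 * laplacian_M G q K = \<rho> K - exp (q K)"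
    and bnd: "\<And>K. K \<in> cells G \<Longrightarrow> c \<le> \<rho> K \<and> \<rho> K \<le> C"
    and K: "K \<in> cells G"
  shows "ln c \<le> q K \<and> q K \<le> ln C"
proof
  have attained: "\<exists>A\<in>cells G. \<forall>L\<in>cells G. h L \<le> h A" for h :: "_ \<Rightarrow> real"
  proof -
    have fin: "finite (h ` cells G)" "h ` cells G \<noteq> {}" using finite_cells[OF G] K by auto
    obtain A where "A \<in> cells G" "Max (h ` cells G) = h A" using Max_in[OF fin] by blast
    then show ?thesis using Max_ge[OF fin(1)] by (metis imageI)
  qed
  obtain A where A: "A \<in> cells G" "\<And>L. L \<in> cells G \<Longrightarrow> q L \<le> q A" using attained[of q] by blast
  have "e\<^sup>2 * laplacian_M G q A \<le> 0"
    by (intro mult_nonneg_nonpos laplacian_nonpos_at_maximum[OF G A(1)] A(2)) auto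
  then have "exp (q A) \<le> C" using eq[OF A(1)] bnd[OF A(1)] by auto
  then have "q A \<le> ln C" using bnd[OF A(1)] c by (simp add: ln_ge_iff)
  then show "q K \<le> ln C" using A(2)[OF K] by linarith
  obtain B where B: "B \<in> cells G" "\<And>L. L \<in> cells G \<Longrightarrow> - q L \<le> - q B"
    using attained[of "\<lambda>L. - q L"] by blast
  have "e\<^sup>2 * laplacian_M G (\<lambda>K. - q K) B \<le> 0"
    by (intro mult_nonneg_nonpos laplacian_nonpos_at_maximum[OF G B(1)] B(2)) auto
  then have "c \<le> exp (q B)" using eq[OF B(1)] bnd[OF B(1)] by (auto simp: laplacian_minus)
  then have "ln c \<le> q B" using ln_mono[OF _ c, of "exp (q B)"] by simp
  then show "ln c \<le> q K" using B(2)[OF K] by linarith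
qed

section \<open>The logarithmic mean\<close>

text \<open>Both inequalities are $1 - 1/t \le \ln t \le t - 1$ for the quotient $t$ of the two
numbers.\<close>

lemma log_mean_between:
  assumes "0 < a" "0 < b"
  shows "min a b \<le> log_mean a b" "log_mean a b \<le> max a b"
proof -
  have main: "x \<le> log_mean x y \<and> log_mean x y \<le> y \<and> log_mean y x = log_mean x y"
    if "0 < x" "x < y" for x y :: real
  proof -
    have l: "ln y - ln x > 0" using that by simp
    have "ln (y / x) \<le> y / x - 1" "ln (x / y) \<le> x / y - 1"
      using that by (intro ln_le_minus_one; simp)+
    then have "ln y - ln x \<le> (y - x) / x" "(y - x) / y \<le> ln y - ln x"
      using that by (simp_all add: ln_div diff_divide_distrib)
    then have "x \<le> (y - x) / (ln y - ln x)" "(y - x) / (ln y - ln x) \<le> y"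
      using that l by (simp_all add: field_simps)
    moreover have "(x - y) / (ln x - ln y) = (y - x) / (ln y - ln x)"
      using minus_divide_divide[of "y - x" "ln y - ln x"] by simp
    ultimately show ?thesis using that by (simp add: log_mean_def)
  qed
  show "min a b \<le> log_mean a b" "log_mean a b \<le> max a b"
    using main[of a b] main[of b a] assms
    by (cases a b rule: linorder_cases; auto simp: log_mean_def min_def max_def)+
qed

text \<open>The logarithmic mean is designed for this discrete chain rule: $\rho\,\partial \ln\rho =
\partial\rho$ holds exactly on the mesh.\<close>

lemma log_mean_times_ln_difference:
  "0 < a \<Longrightarrow> 0 < b \<Longrightarrow> log_mean a b * (ln b - ln a) = b - a"
  by (auto simp: log_mean_def field_simps)

text \<open>Off the diagonal the quotient is continuous; on the diagonal the mean is squeezed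
between the minimum and the maximum of its arguments.\<close>

lemma tendsto_log_mean:
  assumes f: "(f \<longlongrightarrow> a) F" and g: "(g \<longlongrightarrow> b) F" and pos: "0 < a" "0 < b"
  shows "((\<lambda>x. log_mean (f x) (g x)) \<longlongrightarrow> log_mean a b) F"
proof (cases "a = b")
  case True
  have ev: "\<forall>\<^sub>F x in F. 0 < f x \<and> 0 < g x"
    using order_tendstoD(1)[OF f pos(1)] order_tendstoD(1)[OF g pos(2)] by eventually_elim auto
  show ?thesis
  proof (rule tendsto_sandwich[where f = "\<lambda>x. min (f x) (g x)" and h = "\<lambda>x. max (f x) (g x)"])
    show "\<forall>\<^sub>F x in F. min (f x) (g x) \<le> log_mean (f x) (g x)"
      using ev by eventually_elim (auto intro: log_mean_between)
    show "\<forall>\<^sub>F x in F. log_mean (f x) (g x) \<le> max (f x) (g x)"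
      using ev by eventually_elim (auto intro: log_mean_between)
    show "((\<lambda>x. min (f x) (g x)) \<longlongrightarrow> log_mean a b) F"
      using tendsto_min[OF f g] True by (simp add: log_mean_def)
    show "((\<lambda>x. max (f x) (g x)) \<longlongrightarrow> log_mean a b) F"
      using tendsto_max[OF f g] True by (simp add: log_mean_def)
  qed
next
  case False
  have "((\<lambda>x. f x - g x) \<longlongrightarrow> a - b) F" using f g by (rule tendsto_diff)
  then have "\<forall>\<^sub>F x in F. f x - g x \<noteq> 0"
    using False by (intro tendsto_imp_eventually_ne[where c = "a - b"]) auto
  then have "\<forall>\<^sub>F x in F. (f x - g x) / (ln (f x) - ln (g x)) = log_mean (f x) (g x)"
    by eventually_elim (auto simp: log_mean_def)
  moreover have "((\<lambda>x. (f x - g x) / (ln (f x) - ln (g x))) \<longlongrightarrow> (a - b) / (ln a - ln b)) F"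
    using False pos by (intro tendsto_intros f g) auto
  ultimately show ?thesis using False by (simp add: log_mean_def tendsto_cong)
qed

section \<open>Compactness and norms in finite dimension\<close>

lemma simultaneous_convergent_subsequence:
  fixes S :: "(nat \<Rightarrow> real) set"
  assumes "finite S" "\<And>s. s \<in> S \<Longrightarrow> bounded (range s)"
  shows "\<exists>r. strict_mono (r :: nat \<Rightarrow> nat) \<and> (\<forall>s\<in>S. convergent (s \<circ> r))"
  using assms
proof (induction S rule: finite_induct)
  case empty
  show ?case using strict_mono_id by blast
next
  case (insert s S)
  then obtain r where r: "strict_mono (r :: nat \<Rightarrow> nat)" "\<forall>s\<in>S. convergent (s \<circ> r)" by blast
  have "bounded (range (s \<circ> r))"
    using insert.prems[of s] by (auto intro: bounded_subset)
  then obtain l r' where r': "strict_mono (r' :: nat \<Rightarrow> nat)" "((s \<circ> r) \<circ> r') \<longlonglongrightarrow> l"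
    using bounded_imp_convergent_subsequence by blast
  have "convergent (t \<circ> (r \<circ> r'))" if "t \<in> insert s S" for t
    using that r' r(2) convergent_subseq_convergent[OF _ r'(1)]
    by (auto simp: convergent_def comp_assoc[symmetric])
  then show ?case using strict_mono_o[OF r(1) r'(1)] by blast
qed

lemma discrete_norm_rules:
  assumes "discrete_norm I \<N>"
  shows "f \<in> arrays I \<Longrightarrow> 0 \<le> \<N> f" and "\<N> (\<lambda>_. 0) = 0"
    and "f \<in> arrays I \<Longrightarrow> \<N> (\<lambda>k. c * f k) = \<bar>c\<bar> * \<N> f"
    and "f \<in> arrays I \<Longrightarrow> g \<in> arrays I \<Longrightarrow> \<N> (\<lambda>k. f k + g k) \<le> \<N> f + \<N> g"
proof -
  have "(\<lambda>_. 0) \<in> arrays I" by (simp add: arrays_def)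
  then show "\<N> (\<lambda>_. 0) = 0" using assms unfolding discrete_norm_def by blast
qed (use assms in \<open>auto simp only: discrete_norm_def\<close>)

text \<open>Expansion in the standard basis: any norm on a space of finite arrays is dominated by a
weighted $\ell^1$ norm.\<close>

lemma discrete_norm_le_sum:
  assumes N: "discrete_norm I \<N>" and S: "finite S" "S \<subseteq> I"
  shows "\<N> (\<lambda>k. if k \<in> S then f k else 0) \<le> (\<Sum>k\<in>S. \<bar>f k\<bar> * \<N> (\<lambda>l. if l = k then 1 else 0))"
  using S
proof (induction S rule: finite_induct)
  case empty
  show ?case using discrete_norm_rules(2)[OF N] by simp
next
  case (insert k S)
  let ?e = "\<lambda>l. if l = k then 1 else (0::real)" and ?g = "\<lambda>l. if l \<in> S then f l else 0"
  have e: "?e \<in> arrays I" "(\<lambda>l. f k * ?e l) \<in> arrays I" and g: "?g \<in> arrays I"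
    using insert.prems by (auto simp: arrays_def)
  have split: "(\<lambda>l. if l \<in> insert k S then f l else 0) = (\<lambda>l. f k * ?e l + ?g l)"
    using insert.hyps(2) by auto
  have "\<N> ?g \<le> (\<Sum>k\<in>S. \<bar>f k\<bar> * \<N> (\<lambda>l. if l = k then 1 else 0))"
    using insert.IH insert.prems by simp
  then show ?case
    unfolding split sum.insert[OF insert.hyps]
    using discrete_norm_rules(4)[OF N e(2) g] discrete_norm_rules(3)[OF N e(1), of "f k"]
    by linarith
qed

lemma tends_in_any_discrete_norm_if_pointwise:
  fixes I :: "(nat \<times> 'c) set"
  assumes I: "finite I" and lim: "\<And>n k. (n, k) \<in> I \<Longrightarrow> (\<lambda>m. f m n k) \<longlonglongrightarrow> g n k"
  shows "tends_in_any_discrete_norm I f g"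
  unfolding tends_in_any_discrete_norm_def
proof (intro allI impI)
  fix \<N> :: "(nat \<times> 'c \<Rightarrow> real) \<Rightarrow> real"
  assume N: "discrete_norm I \<N>"
  define h where "h m p = f m (fst p) (snd p) - g (fst p) (snd p)" for m p
  have h: "(\<lambda>(n, k). if (n, k) \<in> I then f m n k - g n k else 0) = (\<lambda>p. if p \<in> I then h m p else 0)" for m
    by (auto simp: h_def fun_eq_iff)
  have "(\<lambda>m. \<bar>h m p\<bar>) \<longlonglongrightarrow> 0" if "p \<in> I" for p
    using tendsto_rabs[OF tendsto_diff[OF lim tendsto_const], of "fst p" "snd p" "g (fst p) (snd p)"] that
    by (simp add: h_def)
  then have "(\<lambda>m. \<Sum>p\<in>I. \<bar>h m p\<bar> * \<N> (\<lambda>l. if l = p then 1 else 0)) \<longlonglongrightarrow> 0"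
    by (intro tendsto_null_sum tendsto_mult_left_zero)
  then show "(\<lambda>m. \<N> (\<lambda>(n, k). if (n, k) \<in> I then f m n k - g n k else 0)) \<longlonglongrightarrow> 0"
  proof (rule tendsto_sandwich[OF _ _ tendsto_const, rotated 2])
    have "(\<lambda>p. if p \<in> I then h m p else 0) \<in> arrays I" for m by (simp add: arrays_def)
    then show "\<forall>\<^sub>F m in sequentially. 0 \<le> \<N> (\<lambda>(n, k). if (n, k) \<in> I then f m n k - g n k else 0)"
      unfolding h by (intro always_eventually allI discrete_norm_rules(1)[OF N])
    show "\<forall>\<^sub>F m in sequentially. \<N> (\<lambda>(n, k). if (n, k) \<in> I then f m n k - g n k else 0)
        \<le> (\<Sum>p\<in>I. \<bar>h m p\<bar> * \<N> (\<lambda>l. if l = p then 1 else 0))"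
      unfolding h using discrete_norm_le_sum[OF N I order_refl] by simp
  qed
qed

section \<open>Bounds from the initial data\<close>

text \<open>The integrable majorant is given by $|v_i| \le 1 + |v|^2$; if the restriction to
\<open>A\<close> is not integrable, its integral is 0 by convention.\<close>

lemma initial_velocity_integral_bound:
  fixes \<Omega> :: "(real^'d::finite) set" and A :: "(real^'d) set"
  assumes \<Omega>: "\<Omega> \<in> lmeasurable" and v: "v \<in> L_two_vec \<Omega>"
  shows "\<bar>LINT x:A \<inter> \<Omega>|lebesgue. v x $ i\<bar>
     \<le> vol \<Omega> + (LINT x|lebesgue_on \<Omega>. (norm (v x))\<^sup>2)"
proof -
  have S: "\<Omega> \<inter> space lebesgue \<in> sets lebesgue" using fmeasurableD[OF \<Omega>] by simp
  have fin: "integrable (lebesgue_on \<Omega>) (\<lambda>x. 1::real)"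
    by (rule finite_measure.integrable_const[OF finite_measure_lebesgue_on[OF \<Omega>]])
  have i2: "integrable (lebesgue_on \<Omega>) (\<lambda>x. (norm (v x))\<^sup>2)" using v by (simp add: L_two_vec_def)
  have i3: "integrable lebesgue (\<lambda>x. indicator \<Omega> x *\<^sub>R (1 + (norm (v x))\<^sup>2))"
    using Bochner_Integration.integrable_add[OF fin i2] unfolding integrable_restrict_space[OF S] .
  have "\<bar>LINT x:A \<inter> \<Omega>|lebesgue. v x $ i\<bar> \<le> (LINT x|lebesgue. \<bar>indicator (A \<inter> \<Omega>) x *\<^sub>R (v x $ i)\<bar>)"
    unfolding set_lebesgue_integral_def using integral_norm_bound[of lebesgue "\<lambda>x. indicator (A \<inter> \<Omega>) x *\<^sub>R v x $ i"]
    by simp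
  also have "\<dots> \<le> (LINT x|lebesgue. indicator \<Omega> x *\<^sub>R (1 + (norm (v x))\<^sup>2))"
  proof (rule integral_mono'[OF i3])
    fix x
    have "\<bar>v x $ i\<bar> \<le> norm (v x)" by (rule component_le_norm_cart)
    also have "\<dots> \<le> 1 + (norm (v x))\<^sup>2"
      using zero_le_power2[of "norm (v x) - 1"] zero_le_power2[of "norm (v x)"] norm_ge_zero[of "v x"]
      unfolding power2_diff by (simp del: norm_ge_zero)
    finally show "\<bar>indicator (A \<inter> \<Omega>) x *\<^sub>R (v x $ i)\<bar> \<le> indicator \<Omega> x *\<^sub>R (1 + (norm (v x))\<^sup>2)"
      by (auto simp: indicator_def)
  qed (simp add: indicator_def)
  also have "\<dots> = (LINT x|lebesgue_on \<Omega>. 1 + (norm (v x))\<^sup>2)"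
    by (rule integral_restrict_space[OF S, symmetric])
  also have "\<dots> = vol \<Omega> + (LINT x|lebesgue_on \<Omega>. (norm (v x))\<^sup>2)"
    using Bochner_Integration.integral_add[OF fin i2] \<Omega> by (simp add: measure_restrict_space)
  finally show ?thesis .
qed

lemma integrable_L_infinity_times:
  fixes \<Omega> :: "(real^'d::finite) set"
  assumes f: "f \<in> L_infinity \<Omega>" and g: "integrable (lebesgue_on \<Omega>) (g :: _ \<Rightarrow> real)"
  shows "integrable (lebesgue_on \<Omega>) (\<lambda>x. f x * g x)"
proof -
  obtain B where B: "AE x in lebesgue_on \<Omega>. \<bar>f x\<bar> \<le> B" and m: "f \<in> borel_measurable (lebesgue_on \<Omega>)"
    using f by (auto simp: L_infinity_def)
  have "AE x in lebesgue_on \<Omega>. norm (f x * g x) \<le> norm (B * g x)"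
    using B
  proof eventually_elim
    case (elim x)
    then have "\<bar>f x\<bar> * \<bar>g x\<bar> \<le> \<bar>B\<bar> * \<bar>g x\<bar>" by (intro mult_right_mono) auto
    then show ?case by (simp add: abs_mult)
  qed
  moreover have "integrable (lebesgue_on \<Omega>) (\<lambda>x. B * g x)" using g by simp
  moreover have "(\<lambda>x. f x * g x) \<in> borel_measurable (lebesgue_on \<Omega>)"
    using m g by (intro borel_measurable_times) auto
  ultimately show ?thesis using Bochner_Integration.integrable_bound by blast
qed

text \<open>In the energy density the gradient term is nonnegative and $(\phi - 1) e^{\phi} \ge -1$,
so the kinetic energy is at most the energy plus the volume of the domain; a lower bound of the
density then gives an $L^2$ bound of the velocity.\<close>

lemma energy_controls_velocity:
  fixes \<Omega> :: "(real^'d::finite) set"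
  assumes \<Omega>: "\<Omega> \<in> lmeasurable" and r: "r \<in> L_infinity \<Omega>" and v: "v \<in> L_two_vec \<Omega>"
    and p: "p \<in> L_infinity \<Omega>" and g: "g \<in> L_two_vec \<Omega>"
    and c: "AE x in lebesgue_on \<Omega>. c \<le> r x"
    and E: "(LINT x|lebesgue_on \<Omega>. e\<^sup>2 / 2 * (norm (g x))\<^sup>2 + (p x - 1) * exp (p x)
                                  + 1 / 2 * r x * (norm (v x))\<^sup>2) \<le> C"
  shows "c / 2 * (LINT x|lebesgue_on \<Omega>. (norm (v x))\<^sup>2) \<le> C + vol \<Omega>"
proof -
  let ?M = "lebesgue_on \<Omega>"
  have fin: "integrable ?M (\<lambda>x. 1::real)"
    by (rule finite_measure.integrable_const[OF finite_measure_lebesgue_on[OF \<Omega>]])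
  have iv: "integrable ?M (\<lambda>x. (norm (v x))\<^sup>2)" using v by (simp add: L_two_vec_def)
  have ig: "integrable ?M (\<lambda>x. e\<^sup>2 / 2 * (norm (g x))\<^sup>2)" using g by (simp add: L_two_vec_def)
  have ir: "integrable ?M (\<lambda>x. 1 / 2 * r x * (norm (v x))\<^sup>2)"
    using integrable_mult_right[OF integrable_L_infinity_times[OF r iv], of "1/2"] by (simp add: mult.assoc)
  obtain B where B: "AE x in ?M. \<bar>p x\<bar> \<le> B" and m: "p \<in> borel_measurable ?M"
    using p by (auto simp: L_infinity_def)
  have "AE x in ?M. \<bar>(p x - 1) * exp (p x)\<bar> \<le> (B + 1) * exp B"
    using B
  proof eventually_elim
    case (elim x)
    then show ?case unfolding abs_mult by (intro mult_mono) auto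
  qed
  then have "(\<lambda>x. (p x - 1) * exp (p x)) \<in> L_infinity \<Omega>"
    using m by (auto simp: L_infinity_def intro!: borel_measurable_times borel_measurable_diff borel_measurable_exp)
  from integrable_L_infinity_times[OF this fin]
  have ip: "integrable ?M (\<lambda>x. (p x - 1) * exp (p x))" by simp
  have lower: "(y - 1) * exp y \<ge> - 1" for y :: real
  proof -
    have "(1 - y) \<le> exp (- y)" using exp_ge_add_one_self[of "- y"] by simp
    then have "(1 - y) * exp y \<le> exp (- y) * exp y" by (intro mult_right_mono) auto
    then show ?thesis by (simp add: exp_minus algebra_simps)
  qed
  have "c / 2 * (LINT x|?M. (norm (v x))\<^sup>2) - vol \<Omega> = (LINT x|?M. c / 2 * (norm (v x))\<^sup>2 - 1)"
    using fin iv \<Omega> by (simp add: measure_restrict_space)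
  also have "\<dots> \<le> (LINT x|?M. e\<^sup>2 / 2 * (norm (g x))\<^sup>2 + (p x - 1) * exp (p x)
                                  + 1 / 2 * r x * (norm (v x))\<^sup>2)"
  proof (rule integral_mono_AE)
    show "AE x in ?M. c / 2 * (norm (v x))\<^sup>2 - 1 \<le> e\<^sup>2 / 2 * (norm (g x))\<^sup>2 + (p x - 1) * exp (p x)
                                  + 1 / 2 * r x * (norm (v x))\<^sup>2"
      using c
    proof eventually_elim
      case (elim x)
      then have "c / 2 * (norm (v x))\<^sup>2 \<le> 1 / 2 * r x * (norm (v x))\<^sup>2"
        by (intro mult_right_mono) auto
      moreover have "0 \<le> e\<^sup>2 / 2 * (norm (g x))\<^sup>2" by simp
      ultimately show ?case using lower[of "p x"] by linarith
    qed
  qed (use fin iv ig ip ir in auto)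
  finally show ?thesis using E by simp
qed

lemma initial_velocities_bounded:
  fixes G :: "'d::finite mac_mesh"
  assumes G: "mac_grid G" and \<sigma>: "\<sigma> \<in> int_edges G" and e: "\<And>m. eps m > 0"
    and init: "\<And>m. initialised G (\<rho>\<^sub>0 (eps m)) (u\<^sub>0 (eps m)) (\<phi>\<^sub>0 (eps m)) (\<rho> m) (u m) (\<phi> m)"
    and data: "well_prepared (region G) \<rho>\<^sub>0 u\<^sub>0 \<phi>\<^sub>0"
    and c: "0 < c" "\<And>m. AE x in lebesgue_on (region G). c \<le> \<rho>\<^sub>0 (eps m) x"
  shows "bounded (range (\<lambda>m. u m \<sigma>))"
proof -
  have \<Omega>: "region G \<in> lmeasurable"
    using G unfolding mac_grid_def by (blast intro: bounded_set_imp_lmeasurable lmeasurable_open)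
  have inL: "\<rho>\<^sub>0 (eps m) \<in> L_infinity (region G) \<and> u\<^sub>0 (eps m) \<in> L_two_vec (region G)
      \<and> \<phi>\<^sub>0 (eps m) \<in> L_infinity (region G)" for m
    using data e[of m] unfolding well_prepared_def by blast
  obtain C where C: "\<And>m. \<exists>g \<in> L_two_vec (region G).
      (LINT x|lebesgue_on (region G). (eps m)\<^sup>2 / 2 * (norm (g x))\<^sup>2
          + (\<phi>\<^sub>0 (eps m) x - 1) * exp (\<phi>\<^sub>0 (eps m) x)
          + 1 / 2 * \<rho>\<^sub>0 (eps m) x * (norm (u\<^sub>0 (eps m) x))\<^sup>2) \<le> C"
    using data e unfolding well_prepared_def by meson
  obtain i where i: "\<sigma> \<in> int_edges_dir G i" by (rule int_edge_direction[OF G \<sigma>])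
  let ?V = "vol (region G)"
  have "\<bar>u m \<sigma>\<bar> \<le> 1 / vol (dual_cell G \<sigma>) * (?V + 2 / c * (C + ?V))" for m
  proof -
    let ?J = "LINT x|lebesgue_on (region G). (norm (u\<^sub>0 (eps m) x))\<^sup>2"
    have "c / 2 * ?J \<le> C + ?V"
      using C[of m] energy_controls_velocity[OF \<Omega>] inL[of m] c(2)[of m] by blast
    then have J: "?J \<le> 2 / c * (C + ?V)" using c(1) by (simp add: field_simps)
    have "u m \<sigma> = 1 / vol (dual_cell G \<sigma>)
       * (LINT x:dual_cell G \<sigma> \<inter> region G|lebesgue. u\<^sub>0 (eps m) x $ i)"
      using init[of m] i unfolding initialised_def by blast
    then have "\<bar>u m \<sigma>\<bar> = 1 / vol (dual_cell G \<sigma>)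
       * \<bar>LINT x:dual_cell G \<sigma> \<inter> region G|lebesgue. u\<^sub>0 (eps m) x $ i\<bar>"
      by (simp add: abs_mult)
    also have "\<dots> \<le> 1 / vol (dual_cell G \<sigma>) * (?V + ?J)"
      using inL[of m] by (intro mult_left_mono initial_velocity_integral_bound[OF \<Omega>]) auto
    also have "\<dots> \<le> 1 / vol (dual_cell G \<sigma>) * (?V + 2 / c * (C + ?V))"
      using J by (intro mult_left_mono add_left_mono) auto
    finally show ?thesis .
  qed
  then show ?thesis by (intro boundedI) auto
qed

section \<open>Continuity of the discrete operators\<close>

lemma adjacent_cellsE:
  assumes "mac_grid G" "\<sigma> \<in> int_edges G"
  obtains K L where "adjacent_cells G \<sigma> = (K, L)" "K \<in> cells G" "L \<in> cells G"
proof -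
  obtain K L where KL: "adjacent_cells G \<sigma> = (K, L)" by fastforce
  then have "interface G K L \<sigma>" by (rule adjacent_cells_interface[OF assms])
  then show thesis using that KL by (simp add: interface_def)
qed

lemma tendsto_edge_density:
  assumes "mac_grid G" "\<sigma> \<in> int_edges G"
    and "\<And>K. K \<in> cells G \<Longrightarrow> ((\<lambda>m. q m K) \<longlongrightarrow> l K) F" "\<And>K. K \<in> cells G \<Longrightarrow> 0 < l K"
  shows "((\<lambda>m. edge_density G (q m) \<sigma>) \<longlongrightarrow> edge_density G l \<sigma>) F"
proof -
  obtain K L where "adjacent_cells G \<sigma> = (K, L)" "K \<in> cells G" "L \<in> cells G"
    by (rule adjacent_cellsE[OF assms(1,2)])
  then show ?thesis using assms(3,4) by (simp add: edge_density_def tendsto_log_mean)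
qed

lemma tendsto_dual_average:
  assumes "mac_grid G" "\<sigma> \<in> int_edges G"
    and "\<And>K. K \<in> cells G \<Longrightarrow> ((\<lambda>m. q m K) \<longlongrightarrow> l K) F"
  shows "((\<lambda>m. dual_average G (q m) \<sigma>) \<longlongrightarrow> dual_average G l \<sigma>) F"
proof -
  obtain K L where KL: "adjacent_cells G \<sigma> = (K, L)" "K \<in> cells G" "L \<in> cells G"
    by (rule adjacent_cellsE[OF assms(1,2)])
  have "vol (dual_cell G \<sigma>) \<noteq> 0" using vol_dual_cell_pos[OF assms(1,2)] by simp
  then show ?thesis unfolding dual_average_def KL(1) prod.case
    using KL(2,3) by (intro tendsto_intros assms(3))
qed

lemma tendsto_grad_E:
  assumes "mac_grid G" and "\<And>K. K \<in> cells G \<Longrightarrow> ((\<lambda>m. q m K) \<longlongrightarrow> l K) F"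
  shows "((\<lambda>m. grad_E G (q m) \<sigma>) \<longlongrightarrow> grad_E G l \<sigma>) F"
proof (cases "\<sigma> \<in> int_edges G")
  case True
  obtain K L where KL: "adjacent_cells G \<sigma> = (K, L)" "K \<in> cells G" "L \<in> cells G"
    by (rule adjacent_cellsE[OF assms(1) True])
  have "vol (dual_cell G \<sigma>) \<noteq> 0" using vol_dual_cell_pos[OF assms(1) True] by simp
  then show ?thesis using True KL by (simp add: grad_E_def) (intro tendsto_intros assms(2))
qed (simp add: grad_E_def)

lemma tendsto_div_M:
  assumes "\<And>\<sigma>. ((\<lambda>m. v m \<sigma>) \<longlongrightarrow> l \<sigma>) F"
  shows "((\<lambda>m. div_M (v m) K) \<longlongrightarrow> div_M l K) F"
  unfolding div_M_def by (intro tendsto_intros assms)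

lemma tendsto_laplacian_M:
  assumes "mac_grid G" and "\<And>K. K \<in> cells G \<Longrightarrow> ((\<lambda>m. q m K) \<longlongrightarrow> l K) F"
  shows "((\<lambda>m. laplacian_M G (q m) K) \<longlongrightarrow> laplacian_M G l K) F"
  unfolding laplacian_M_def by (intro tendsto_div_M tendsto_grad_E assms)

lemma tendsto_mass_flux:
  assumes "mac_grid G" and "\<And>\<sigma>. \<sigma> \<in> int_edges G \<Longrightarrow> ((\<lambda>m. \<eta> m \<sigma>) \<longlongrightarrow> \<eta>l \<sigma>) F"
    and "\<And>K. K \<in> cells G \<Longrightarrow> ((\<lambda>m. \<rho> m K) \<longlongrightarrow> \<rho>l K) F" "\<And>K. K \<in> cells G \<Longrightarrow> 0 < \<rho>l K"
    and "\<And>\<sigma>. ((\<lambda>m. u m \<sigma>) \<longlongrightarrow> U \<sigma>) F"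
    and "\<And>K. K \<in> cells G \<Longrightarrow> ((\<lambda>m. \<psi> m K) \<longlongrightarrow> \<psi>l K) F"
  shows "((\<lambda>m. mass_flux G \<delta>t (\<eta> m) (\<rho> m) (u m) (\<psi> m) \<sigma> K)
    \<longlongrightarrow> mass_flux G \<delta>t \<eta>l \<rho>l U \<psi>l \<sigma> K) F"
  unfolding mass_flux_def
  by (cases "\<sigma> \<in> int_edges G")
     (auto intro!: tendsto_intros tendsto_edge_density tendsto_grad_E assms)

lemma tendsto_dual_flux:
  assumes "\<And>\<tau> K. ((\<lambda>m. \<Phi> m \<tau> K) \<longlongrightarrow> \<Phi>l \<tau> K) F"
  shows "((\<lambda>m. dual_flux G w (\<Phi> m) \<epsilon> \<sigma>) \<longlongrightarrow> dual_flux G w \<Phi>l \<epsilon> \<sigma>) F"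
  unfolding dual_flux_def by (intro tendsto_intros assms)

text \<open>The upwind value jumps when the flux changes sign, but it is multiplied by the flux,
which vanishes there: the product is $F^+ u_\sigma + F^- u_{\sigma'}$ with the continuous positive
and negative parts of $F$.\<close>

lemma tendsto_upwind_flux:
  assumes "\<And>\<tau> K. ((\<lambda>m. \<Phi> m \<tau> K) \<longlongrightarrow> \<Phi>l \<tau> K) F" "\<And>\<sigma>. ((\<lambda>m. u m \<sigma>) \<longlongrightarrow> U \<sigma>) F"
  shows "((\<lambda>m. dual_flux G w (\<Phi> m) \<epsilon> \<sigma> * upwind G w (\<Phi> m) (u m) \<epsilon> \<sigma>)
    \<longlongrightarrow> dual_flux G w \<Phi>l \<epsilon> \<sigma> * upwind G w \<Phi>l U \<epsilon> \<sigma>) F"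
proof -
  have split: "dual_flux G w \<Psi> \<epsilon> \<sigma> * upwind G w \<Psi> v \<epsilon> \<sigma> =
     max (dual_flux G w \<Psi> \<epsilon> \<sigma>) 0 * v \<sigma> + min (dual_flux G w \<Psi> \<epsilon> \<sigma>) 0 * v (dual_neighbour G \<epsilon> \<sigma>)"
    for \<Psi> v by (simp add: upwind_def max_def min_def)
  show ?thesis unfolding split by (intro tendsto_intros tendsto_dual_flux assms)
qed

lemma grad_E_scale: "grad_E G (\<lambda>K. c * q K) \<sigma> = c * grad_E G q \<sigma>"
  by (simp add: grad_E_def algebra_simps split: prod.split)

text \<open>This identity turns $\rho^n_\sigma\,\partial\ln\rho^{n+1}$, the limit of
$\rho^n_\sigma\,\partial\phi^{n+1}$, into the first two terms of \<open>grad_star\<close>,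
$\partial\rho^{n+1} - (\rho^{n+1}_\sigma - \rho^n_\sigma)\,\partial\ln\rho^{n+1}$.\<close>

lemma edge_density_times_grad_ln:
  assumes "mac_grid G" "\<sigma> \<in> int_edges G" and "\<And>K. K \<in> cells G \<Longrightarrow> 0 < \<rho> K"
  shows "edge_density G \<rho> \<sigma> * grad_E G (\<lambda>K. ln (\<rho> K)) \<sigma> = grad_E G \<rho> \<sigma>"
proof -
  obtain K L where KL: "adjacent_cells G \<sigma> = (K, L)" "K \<in> cells G" "L \<in> cells G"
    by (rule adjacent_cellsE[OF assms(1,2)])
  have "log_mean (\<rho> K) (\<rho> L) * (c * (ln (\<rho> L) - ln (\<rho> K)) * d) = c * (\<rho> L - \<rho> K) * d" for c d
    using log_mean_times_ln_difference[OF assms(3)[OF KL(2)] assms(3)[OF KL(3)]]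
    by (metis mult.assoc mult.left_commute)
  then show ?thesis using assms(2) by (simp only: grad_E_def edge_density_def KL(1) prod.case if_True)
qed

lemma momentum_step_eq:
  fixes G :: "'d::finite mac_mesh"
  assumes "mac_scheme G w \<delta>t N e \<eta> \<rho> u \<phi>" "n < N" "mac_grid G" "\<sigma> \<in> int_edges G"
  defines "\<Phi> \<equiv> mass_flux G \<delta>t (\<eta> n) (\<rho> n) (u n) (\<phi> (Suc n))"
  shows "1 / \<delta>t * (dual_average G (\<rho> (Suc n)) \<sigma> * u (Suc n) \<sigma> - dual_average G (\<rho> n) \<sigma> * u n \<sigma>)
     + 1 / vol (dual_cell G \<sigma>)
       * (\<Sum>\<epsilon>\<in>dual_edges G \<sigma>. dual_flux G w \<Phi> \<epsilon> \<sigma> * upwind G w \<Phi> (u n) \<epsilon> \<sigma>)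
     = - edge_density G (\<rho> n) \<sigma> * grad_E G (\<phi> (Suc n)) \<sigma> + \<delta>t * grad_E G (div_M (u n)) \<sigma>"
proof -
  obtain i where "\<sigma> \<in> int_edges_dir G i" by (rule int_edge_direction[OF assms(3,4)])
  then show ?thesis
    using assms(1,2) unfolding mac_scheme_def Let_def \<Phi>_def by (simp only: grad_E_scale)
qed

section \<open>The quasi-neutral limit\<close>

theorem theorem6p8:
  fixes G :: "'d::finite mac_mesh"
    and w :: "(real^'d) set \<Rightarrow> (real^'d) set \<Rightarrow> (real^'d) set \<Rightarrow> (real^'d) set \<Rightarrow> real"
    and \<delta>t :: real and N :: nat
    and eps :: "nat \<Rightarrow> real"
    and \<rho>\<^sub>0 \<phi>\<^sub>0 :: "real \<Rightarrow> real^'d \<Rightarrow> real"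
    and u\<^sub>0 :: "real \<Rightarrow> real^'d \<Rightarrow> real^'d"
    and \<eta> \<rho> u \<phi> :: "nat \<Rightarrow> nat \<Rightarrow> (real^'d) set \<Rightarrow> real"
    and C_low C_up c\<^sub>0 \<kappa> \<eta>_max :: real
  assumes dim: "CARD('d) \<in> {1, 2, 3}"
    and grid: "mac_grid G"
    and weights: "dual_flux_weights G w"
    and time: "\<delta>t > 0" "N > 0"
    and eps: "\<And>m. eps m > 0" "eps \<longlonglongrightarrow> 0"
    and scheme: "\<And>m. mac_scheme G w \<delta>t N (eps m) (\<eta> m) (\<rho> m) (u m) (\<phi> m)"
    and init: "\<And>m. initialised G (\<rho>\<^sub>0 (eps m)) (u\<^sub>0 (eps m)) (\<phi>\<^sub>0 (eps m)) (\<rho> m 0) (u m 0) (\<phi> m 0)"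
    and data: "well_prepared (region G) \<rho>\<^sub>0 u\<^sub>0 \<phi>\<^sub>0"
    and bounds: "0 < C_low"
      "\<And>m n K. n \<le> N \<Longrightarrow> K \<in> cells G \<Longrightarrow> C_low < \<rho> m n K \<and> \<rho> m n K < C_up"
    \<comment> \<open>lower bound for the initial densities, uniform in m\<close>
    and data_lower: "0 < c\<^sub>0" "\<And>m. AE x in lebesgue_on (region G). c\<^sub>0 \<le> \<rho>\<^sub>0 (eps m) x"
    \<comment> \<open>the choice of the stabilisation parameter is uniform in m\<close>
    and eta: "0 < \<kappa>"
      "\<And>m n \<sigma>. n < N \<Longrightarrow> \<sigma> \<in> int_edges G \<Longrightarrow>
         5 * (edge_density G (\<rho> m n) \<sigma>)\<^sup>2 / (4 * dual_average G (\<rho> m n) \<sigma>) + \<kappa> \<le> \<eta> m n \<sigma> \<and>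
         \<eta> m n \<sigma> \<le> \<eta>_max"
  shows "\<exists>r \<rho>l U \<eta>l. strict_mono (r :: nat \<Rightarrow> nat) \<and>
    (\<forall>n\<le>N. \<rho>l n \<in> L_M G \<and> U n \<in> H_E0 G \<and> (\<forall>K\<in>cells G. \<rho>l n K > 0)) \<and>
    tends_in_any_discrete_norm ({0..N} \<times> cells G) (\<rho> \<circ> r) \<rho>l \<and>
    tends_in_any_discrete_norm ({0..N} \<times> int_edges G) (u \<circ> r) U \<and>
    tends_in_any_discrete_norm ({1..N} \<times> cells G) (\<phi> \<circ> r) (\<lambda>n K. ln (\<rho>l n K)) \<and>
    (\<forall>n<N. \<forall>\<sigma>\<in>int_edges G. (\<lambda>m. \<eta> (r m) n \<sigma>) \<longlonglongrightarrow> \<eta>l n \<sigma>) \<and>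
    limit_scheme G w \<delta>t N \<eta>l \<rho>l U"
proof -
  have \<rho>_range: "C_low < \<rho> m n K" "\<rho> m n K < C_up" if "n \<le> N" "K \<in> cells G" for m n K
    using bounds(2)[OF that] by auto
  have \<rho>_pos: "0 < \<rho> m n K" if "n \<le> N" "K \<in> cells G" for m n K
    using bounds(1) \<rho>_range(1)[OF that] by (rule less_trans)
  \<comment> \<open>The potential inherits the bounds of the density, uniformly in \<open>m\<close>.\<close>
  have \<phi>_range: "ln C_low \<le> \<phi> m (Suc n) K \<and> \<phi> m (Suc n) K \<le> ln C_up"
    if n: "n < N" and K: "K \<in> cells G" for m n K
  proof (rule poisson_maximum_principle[OF grid bounds(1) _ _ K])
    show "- (eps m)\<^sup>2 * laplacian_M G (\<phi> m (Suc n)) L = \<rho> m (Suc n) L - exp (\<phi> m (Suc n) L)"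
      if "L \<in> cells G" for L
      using scheme[of m] n that unfolding mac_scheme_def Let_def by blast
    show "C_low \<le> \<rho> m (Suc n) L \<and> \<rho> m (Suc n) L \<le> C_up" if "L \<in> cells G" for L
      using \<rho>_range[of "Suc n" L m] n that by simp
  qed

  \<comment> \<open>The velocities after the initial one are left out: they are determined by the listed quantities, and
      their convergence follows from the scheme.\<close>
  define S where "S =
    (\<lambda>(n, K) m. \<rho> m n K) ` ({..N} \<times> cells G) \<union>
    (\<lambda>(n, K) m. \<phi> m (Suc n) K) ` ({..<N} \<times> cells G) \<union>
    (\<lambda>(n, \<sigma>) m. \<eta> m n \<sigma>) ` ({..<N} \<times> int_edges G) \<union>
    (\<lambda>\<sigma> m. u m 0 \<sigma>) ` int_edges G"
  have "finite S"
    unfolding S_def using finite_cells[OF grid] finite_int_edges[OF grid] by simp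
  moreover have "bounded (range s)" if "s \<in> S" for s
  proof -
    consider (\<rho>) n K where "n \<le> N" "K \<in> cells G" "s = (\<lambda>m. \<rho> m n K)"
      | (\<phi>) n K where "n < N" "K \<in> cells G" "s = (\<lambda>m. \<phi> m (Suc n) K)"
      | (\<eta>) n \<sigma> where "n < N" "\<sigma> \<in> int_edges G" "s = (\<lambda>m. \<eta> m n \<sigma>)"
      | (u) \<sigma> where "\<sigma> \<in> int_edges G" "s = (\<lambda>m. u m 0 \<sigma>)"
      using \<open>s \<in> S\<close> unfolding S_def by auto
    then show ?thesis
    proof cases
      case \<rho>
      have "range s \<subseteq> {C_low..C_up}"
        using \<rho>_range[OF \<rho>(1,2)] unfolding \<rho>(3) by (simp add: image_subset_iff less_imp_le)
      then show ?thesis by (rule bounded_subset[OF bounded_closed_interval])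
    next
      case \<phi>
      have "range s \<subseteq> {ln C_low..ln C_up}" using \<phi>_range[OF \<phi>(1,2)] unfolding \<phi>(3) by auto
      then show ?thesis by (rule bounded_subset[OF bounded_closed_interval])
    next
      case \<eta>
      have "0 \<le> \<eta> m n \<sigma>" for m
      proof -
        have "dual_average G (\<rho> m n) \<sigma> > 0"
          using \<eta>(1) by (intro dual_average_pos[OF grid \<eta>(2)] \<rho>_pos) auto
        then have "0 \<le> 5 * (edge_density G (\<rho> m n) \<sigma>)\<^sup>2 / (4 * dual_average G (\<rho> m n) \<sigma>)" by simp
        then show ?thesis using eta(1) eta(2)[OF \<eta>(1,2), of m] by linarith
      qed
      then have "range s \<subseteq> {0..\<eta>_max}" using eta(2)[OF \<eta>(1,2)] unfolding \<eta>(3) by auto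
      then show ?thesis by (rule bounded_subset[OF bounded_closed_interval])
    next
      case u
      show ?thesis unfolding u(2)
        by (rule initial_velocities_bounded[OF grid u(1) eps(1) init data data_lower])
    qed
  qed
  ultimately obtain r where r: "strict_mono (r :: nat \<Rightarrow> nat)"
    and conv: "\<And>s. s \<in> S \<Longrightarrow> convergent (s \<circ> r)"
    using simultaneous_convergent_subsequence[of S] by blast

  \<comment> \<open>The zero values outside the grid make the limit an element of \<open>L_M G\<close>; for the velocities this is
      automatic.\<close>
  define \<rho>l where "\<rho>l n K = (if K \<in> cells G then lim (\<lambda>m. \<rho> (r m) n K) else 0)" for n K
  define \<eta>l where "\<eta>l n \<sigma> = lim (\<lambda>m. \<eta> (r m) n \<sigma>)" for n \<sigma>
  have lim_\<rho>: "(\<lambda>m. \<rho> (r m) n K) \<longlonglongrightarrow> \<rho>l n K" if "n \<le> N" "K \<in> cells G" for n K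
  proof -
    have "(\<lambda>m. \<rho> m n K) \<in> S" unfolding S_def using that by auto
    then show ?thesis using conv that(2) by (fastforce simp: \<rho>l_def convergent_LIMSEQ_iff o_def)
  qed
  have lim_\<eta>: "(\<lambda>m. \<eta> (r m) n \<sigma>) \<longlonglongrightarrow> \<eta>l n \<sigma>" if "n < N" "\<sigma> \<in> int_edges G" for n \<sigma>
  proof -
    have "(\<lambda>m. \<eta> m n \<sigma>) \<in> S" unfolding S_def using that by auto
    then show ?thesis using conv by (fastforce simp: \<eta>l_def convergent_LIMSEQ_iff o_def)
  qed
  have \<rho>l_pos: "0 < \<rho>l n K" if "n \<le> N" "K \<in> cells G" for n K
  proof -
    have "C_low \<le> \<rho>l n K"
      by (rule tendsto_lowerbound[OF lim_\<rho>[OF that]]) (use \<rho>_range[OF that] in \<open>simp_all add: less_imp_le\<close>)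
    then show ?thesis using bounds(1) by linarith
  qed

  have lim_\<phi>: "(\<lambda>m. \<phi> (r m) (Suc n) K) \<longlonglongrightarrow> ln (\<rho>l (Suc n) K)" if n: "n < N" and K: "K \<in> cells G" for n K
  proof -
    define \<phi>l where "\<phi>l L = lim (\<lambda>m. \<phi> (r m) (Suc n) L)" for L
    have lim: "(\<lambda>m. \<phi> (r m) (Suc n) L) \<longlonglongrightarrow> \<phi>l L" if "L \<in> cells G" for L
    proof -
      have "(\<lambda>m. \<phi> m (Suc n) L) \<in> S" unfolding S_def using n that by auto
      then show ?thesis using conv by (fastforce simp: \<phi>l_def convergent_LIMSEQ_iff o_def)
    qed
    \<comment> \<open>The discrete Laplacian of the convergent potentials converges, so the left-hand side of the Poisson
      equation tends to 0.\<close>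
    have "(\<lambda>m. eps (r m)) \<longlonglongrightarrow> 0"
      using LIMSEQ_subseq_LIMSEQ[OF eps(2) r] by (simp add: o_def)
    from tendsto_mult[OF tendsto_minus[OF tendsto_power[OF this, of 2]] tendsto_laplacian_M[OF grid lim]]
    have "(\<lambda>m. - (eps (r m))\<^sup>2 * laplacian_M G (\<phi> (r m) (Suc n)) K) \<longlonglongrightarrow> 0" by simp
    moreover have "- (eps (r m))\<^sup>2 * laplacian_M G (\<phi> (r m) (Suc n)) K
        = \<rho> (r m) (Suc n) K - exp (\<phi> (r m) (Suc n) K)" for m
      using scheme[of "r m"] n K unfolding mac_scheme_def Let_def by blast
    ultimately have "(\<lambda>m. \<rho> (r m) (Suc n) K - exp (\<phi> (r m) (Suc n) K)) \<longlonglongrightarrow> 0" by simp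
    moreover have "(\<lambda>m. \<rho> (r m) (Suc n) K - exp (\<phi> (r m) (Suc n) K)) \<longlonglongrightarrow> \<rho>l (Suc n) K - exp (\<phi>l K)"
      using n K by (intro tendsto_intros lim lim_\<rho>) auto
    ultimately have "\<rho>l (Suc n) K - exp (\<phi>l K) = 0" by (rule LIMSEQ_unique[rotated])
    then have "\<phi>l K = ln (\<rho>l (Suc n) K)" by simp
    then show ?thesis using lim[OF K] by simp
  qed

  define \<Phi> where "\<Phi> m n = mass_flux G \<delta>t (\<eta> m n) (\<rho> m n) (u m n) (\<phi> m (Suc n))" for m n
  define U where "U n \<sigma> = lim (\<lambda>m. u (r m) n \<sigma>)" for n \<sigma>
  define \<Phi>l where "\<Phi>l n = mass_flux G \<delta>t (\<eta>l n) (\<rho>l n) (U n) (\<lambda>K. ln (\<rho>l (Suc n) K))" for n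
  have u_out: "u m n \<sigma> = 0" if "n \<le> N" "\<sigma> \<notin> int_edges G" for m n \<sigma>
    using scheme[of m] that unfolding mac_scheme_def H_E0_def by blast
  have lim_\<Phi>: "(\<lambda>m. \<Phi> (r m) n \<tau> K) \<longlonglongrightarrow> \<Phi>l n \<tau> K"
    if n: "n < N" and un: "\<And>\<sigma>. (\<lambda>m. u (r m) n \<sigma>) \<longlonglongrightarrow> U n \<sigma>" for n \<tau> K
    unfolding \<Phi>_def \<Phi>l_def using n
    by (intro tendsto_mass_flux[OF grid] lim_\<eta> lim_\<rho> \<rho>l_pos lim_\<phi> un) auto
  have lim_mom: "(\<lambda>m. 1 / vol (dual_cell G \<sigma>)
        * (\<Sum>\<epsilon>\<in>dual_edges G \<sigma>. dual_flux G w (\<Phi> (r m) n) \<epsilon> \<sigma> * upwind G w (\<Phi> (r m) n) (u (r m) n) \<epsilon> \<sigma>))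
      \<longlonglongrightarrow> 1 / vol (dual_cell G \<sigma>)
        * (\<Sum>\<epsilon>\<in>dual_edges G \<sigma>. dual_flux G w (\<Phi>l n) \<epsilon> \<sigma> * upwind G w (\<Phi>l n) (U n) \<epsilon> \<sigma>)"
    if n: "n < N" and un: "\<And>\<sigma>. (\<lambda>m. u (r m) n \<sigma>) \<longlonglongrightarrow> U n \<sigma>" for n \<sigma>
    by (intro tendsto_mult tendsto_const tendsto_sum tendsto_upwind_flux lim_\<Phi> n un)
  have lim_rhs: "(\<lambda>m. - edge_density G (\<rho> (r m) n) \<sigma> * grad_E G (\<phi> (r m) (Suc n)) \<sigma>
          + \<delta>t * grad_E G (div_M (u (r m) n)) \<sigma>)
      \<longlonglongrightarrow> - edge_density G (\<rho>l n) \<sigma> * grad_E G (\<lambda>K. ln (\<rho>l (Suc n) K)) \<sigma>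
          + \<delta>t * grad_E G (div_M (U n)) \<sigma>"
    if n: "n < N" and un: "\<And>\<sigma>. (\<lambda>m. u (r m) n \<sigma>) \<longlonglongrightarrow> U n \<sigma>" and \<sigma>: "\<sigma> \<in> int_edges G" for n \<sigma>
    using n by (intro tendsto_intros tendsto_edge_density tendsto_grad_E tendsto_div_M
        grid \<sigma> lim_\<rho> \<rho>l_pos lim_\<phi> un) auto
  have lim_avg: "(\<lambda>m. dual_average G (\<rho> (r m) n) \<sigma>) \<longlonglongrightarrow> dual_average G (\<rho>l n) \<sigma>"
    and avg_pos: "0 < dual_average G (\<rho>l n) \<sigma>"
    if "n \<le> N" "\<sigma> \<in> int_edges G" for n \<sigma>
    using that by (auto intro: tendsto_dual_average dual_average_pos grid lim_\<rho> \<rho>l_pos)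

  \<comment> \<open>The momentum equation gives the new velocity as a continuous function of convergent quantities, the
      division by the averaged density being harmless as its limit is positive.\<close>
  have lim_u: "(\<lambda>m. u (r m) n \<sigma>) \<longlonglongrightarrow> U n \<sigma>" if "n \<le> N" for n \<sigma>
    using that
  proof (induction n arbitrary: \<sigma>)
    case 0
    show ?case
    proof (cases "\<sigma> \<in> int_edges G")
      case True
      then have "(\<lambda>m. u m 0 \<sigma>) \<in> S" unfolding S_def by auto
      then show ?thesis using conv by (fastforce simp: U_def convergent_LIMSEQ_iff o_def)
    qed (simp add: U_def u_out)
  next
    case (Suc n)
    then have n: "n < N" and un: "\<And>\<sigma>. (\<lambda>m. u (r m) n \<sigma>) \<longlonglongrightarrow> U n \<sigma>" by auto
    show ?case
    proof (cases "\<sigma> \<in> int_edges G")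
      case True
      define M where "M m = 1 / vol (dual_cell G \<sigma>) * (\<Sum>\<epsilon>\<in>dual_edges G \<sigma>.
          dual_flux G w (\<Phi> m n) \<epsilon> \<sigma> * upwind G w (\<Phi> m n) (u m n) \<epsilon> \<sigma>)" for m
      define R where "R m = - edge_density G (\<rho> m n) \<sigma> * grad_E G (\<phi> m (Suc n)) \<sigma>
          + \<delta>t * grad_E G (div_M (u m n)) \<sigma>" for m
      have "u m (Suc n) \<sigma> = (dual_average G (\<rho> m n) \<sigma> * u m n \<sigma> + \<delta>t * (R m - M m))
          / dual_average G (\<rho> m (Suc n)) \<sigma>" for m
      proof -
        have "dual_average G (\<rho> m (Suc n)) \<sigma> > 0"
          using n by (intro dual_average_pos[OF grid True] \<rho>_pos) auto
        then show ?thesis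
          using momentum_step_eq[OF scheme n grid True, of m] time(1)
          unfolding R_def M_def \<Phi>_def by (simp add: field_simps)
      qed
      moreover have "convergent (\<lambda>m. (dual_average G (\<rho> (r m) n) \<sigma> * u (r m) n \<sigma> + \<delta>t * (R (r m) - M (r m)))
          / dual_average G (\<rho> (r m) (Suc n)) \<sigma>)"
        unfolding convergent_def R_def M_def
        by (rule exI, rule tendsto_divide[OF tendsto_add[OF tendsto_mult[OF lim_avg un]
              tendsto_mult[OF tendsto_const tendsto_diff[OF lim_rhs[OF n un] lim_mom[OF n un]]]]
              lim_avg]) (use n True avg_pos[of "Suc n" \<sigma>] in auto)
      ultimately show ?thesis by (simp add: U_def convergent_LIMSEQ_iff)
    qed (use Suc.prems in \<open>simp add: U_def u_out\<close>)
  qed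

  have scheme_l: "limit_scheme G w \<delta>t N \<eta>l \<rho>l U"
    unfolding limit_scheme_def Let_def \<Phi>l_def[symmetric]
  proof (intro allI impI conjI ballI)
    fix n assume n: "n < N"
    then have un: "\<And>\<sigma>. (\<lambda>m. u (r m) n \<sigma>) \<longlonglongrightarrow> U n \<sigma>" using lim_u by simp
    show "eta_condition G (\<rho>l n) (\<eta>l n)"
      unfolding eta_condition_def
    proof
      fix \<sigma> assume \<sigma>: "\<sigma> \<in> int_edges G"
      \<comment> \<open>The margin \<open>\<kappa>\<close> keeps the inequality strict in the limit.\<close>
      have "(\<lambda>m. 5 * (edge_density G (\<rho> (r m) n) \<sigma>)\<^sup>2 / (4 * dual_average G (\<rho> (r m) n) \<sigma>) + \<kappa>)
        \<longlonglongrightarrow> 5 * (edge_density G (\<rho>l n) \<sigma>)\<^sup>2 / (4 * dual_average G (\<rho>l n) \<sigma>) + \<kappa>"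
        using n avg_pos[of n \<sigma>] \<sigma>
        by (intro tendsto_intros tendsto_edge_density grid \<sigma> lim_\<rho> \<rho>l_pos lim_avg) auto
      then have "5 * (edge_density G (\<rho>l n) \<sigma>)\<^sup>2 / (4 * dual_average G (\<rho>l n) \<sigma>) + \<kappa> \<le> \<eta>l n \<sigma>"
        by (rule LIMSEQ_le[OF _ lim_\<eta>[OF n \<sigma>]]) (use eta(2)[OF n \<sigma>] in blast)
      then show "5 * (edge_density G (\<rho>l n) \<sigma>)\<^sup>2 / (4 * dual_average G (\<rho>l n) \<sigma>) < \<eta>l n \<sigma>"
        using eta(1) by linarith
    qed
    show "1 / \<delta>t * (\<rho>l (Suc n) K - \<rho>l n K) + 1 / vol K * (\<Sum>\<sigma>\<in>edges_of K. \<Phi>l n \<sigma> K) = 0"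
      if K: "K \<in> cells G" for K
    proof (rule LIMSEQ_unique)
      show "(\<lambda>m. 1 / \<delta>t * (\<rho> (r m) (Suc n) K - \<rho> (r m) n K)
          + 1 / vol K * (\<Sum>\<sigma>\<in>edges_of K. \<Phi> (r m) n \<sigma> K))
        \<longlonglongrightarrow> 1 / \<delta>t * (\<rho>l (Suc n) K - \<rho>l n K) + 1 / vol K * (\<Sum>\<sigma>\<in>edges_of K. \<Phi>l n \<sigma> K)"
        using n K by (intro tendsto_add tendsto_mult tendsto_const tendsto_diff tendsto_sum lim_\<rho> lim_\<Phi> un) auto
      have "1 / \<delta>t * (\<rho> (r m) (Suc n) K - \<rho> (r m) n K)
          + 1 / vol K * (\<Sum>\<sigma>\<in>edges_of K. \<Phi> (r m) n \<sigma> K) = 0" for m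
        using scheme[of "r m"] n K unfolding mac_scheme_def Let_def \<Phi>_def by blast
      then show "(\<lambda>m. 1 / \<delta>t * (\<rho> (r m) (Suc n) K - \<rho> (r m) n K)
          + 1 / vol K * (\<Sum>\<sigma>\<in>edges_of K. \<Phi> (r m) n \<sigma> K)) \<longlonglongrightarrow> 0" by simp
    qed
    show "1 / \<delta>t * (dual_average G (\<rho>l (Suc n)) \<sigma> * U (Suc n) \<sigma> - dual_average G (\<rho>l n) \<sigma> * U n \<sigma>)
        + 1 / vol (dual_cell G \<sigma>)
          * (\<Sum>\<epsilon>\<in>dual_edges G \<sigma>. dual_flux G w (\<Phi>l n) \<epsilon> \<sigma> * upwind G w (\<Phi>l n) (U n) \<epsilon> \<sigma>)
        + grad_star G \<delta>t (\<rho>l n) (\<rho>l (Suc n)) (U n) \<sigma> = 0"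
      if "\<sigma> \<in> int_edges_dir G i" for i \<sigma>
    proof -
      have \<sigma>: "\<sigma> \<in> int_edges G" using that by (simp add: int_edges_dir_def)
      have "(\<lambda>m. 1 / \<delta>t * (dual_average G (\<rho> (r m) (Suc n)) \<sigma> * u (r m) (Suc n) \<sigma>
            - dual_average G (\<rho> (r m) n) \<sigma> * u (r m) n \<sigma>)
          + 1 / vol (dual_cell G \<sigma>) * (\<Sum>\<epsilon>\<in>dual_edges G \<sigma>.
              dual_flux G w (\<Phi> (r m) n) \<epsilon> \<sigma> * upwind G w (\<Phi> (r m) n) (u (r m) n) \<epsilon> \<sigma>))
        \<longlonglongrightarrow> 1 / \<delta>t * (dual_average G (\<rho>l (Suc n)) \<sigma> * U (Suc n) \<sigma> - dual_average G (\<rho>l n) \<sigma> * U n \<sigma>)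
          + 1 / vol (dual_cell G \<sigma>) * (\<Sum>\<epsilon>\<in>dual_edges G \<sigma>.
              dual_flux G w (\<Phi>l n) \<epsilon> \<sigma> * upwind G w (\<Phi>l n) (U n) \<epsilon> \<sigma>)"
        using n \<sigma>
        by (intro tendsto_add[OF _ lim_mom[OF n un]] tendsto_mult tendsto_const tendsto_diff lim_avg lim_u) auto
      from LIMSEQ_unique[OF this] lim_rhs[OF n un \<sigma>]
      have "1 / \<delta>t * (dual_average G (\<rho>l (Suc n)) \<sigma> * U (Suc n) \<sigma> - dual_average G (\<rho>l n) \<sigma> * U n \<sigma>)
          + 1 / vol (dual_cell G \<sigma>) * (\<Sum>\<epsilon>\<in>dual_edges G \<sigma>.
              dual_flux G w (\<Phi>l n) \<epsilon> \<sigma> * upwind G w (\<Phi>l n) (U n) \<epsilon> \<sigma>)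
        = - edge_density G (\<rho>l n) \<sigma> * grad_E G (\<lambda>K. ln (\<rho>l (Suc n) K)) \<sigma>
          + \<delta>t * grad_E G (div_M (U n)) \<sigma>"
        unfolding momentum_step_eq[OF scheme n grid \<sigma>, folded \<Phi>_def] .
      moreover have "edge_density G (\<rho>l (Suc n)) \<sigma> * grad_E G (\<lambda>K. ln (\<rho>l (Suc n) K)) \<sigma>
          = grad_E G (\<rho>l (Suc n)) \<sigma>"
        using n \<rho>l_pos by (intro edge_density_times_grad_ln[OF grid \<sigma>]) auto
      ultimately show ?thesis unfolding grad_star_def by (simp add: algebra_simps)
    qed
  qed

  have U_out: "U n \<in> H_E0 G" if "n \<le> N" for n
    using u_out[OF that] by (simp add: U_def H_E0_def)
  have fin: "finite ({0..N} \<times> cells G)" "finite ({1..N} \<times> cells G)" "finite ({0..N} \<times> int_edges G)"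
    using finite_cells[OF grid] finite_int_edges[OF grid] by auto
  show ?thesis
  proof (intro exI conjI)
    show "\<forall>n\<le>N. \<rho>l n \<in> L_M G \<and> U n \<in> H_E0 G \<and> (\<forall>K\<in>cells G. \<rho>l n K > 0)"
      using U_out \<rho>l_pos by (simp add: L_M_def \<rho>l_def)
    show "tends_in_any_discrete_norm ({0..N} \<times> cells G) (\<rho> \<circ> r) \<rho>l"
      using lim_\<rho> by (intro tends_in_any_discrete_norm_if_pointwise fin) auto
    show "tends_in_any_discrete_norm ({0..N} \<times> int_edges G) (u \<circ> r) U"
      using lim_u by (intro tends_in_any_discrete_norm_if_pointwise fin) auto
    show "tends_in_any_discrete_norm ({1..N} \<times> cells G) (\<phi> \<circ> r) (\<lambda>n K. ln (\<rho>l n K))"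
    proof (rule tends_in_any_discrete_norm_if_pointwise[OF fin(2)])
      fix n K assume "(n, K) \<in> {1..N} \<times> cells G"
      then show "(\<lambda>m. (\<phi> \<circ> r) m n K) \<longlonglongrightarrow> ln (\<rho>l n K)"
        using lim_\<phi>[of "n - 1" K] by auto
    qed
    show "\<forall>n<N. \<forall>\<sigma>\<in>int_edges G. (\<lambda>m. \<eta> (r m) n \<sigma>) \<longlonglongrightarrow> \<eta>l n \<sigma>" using lim_\<eta> by blast
  qed (fact r scheme_l)+
qed

end
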